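(* Let $(M,J,g)$ be an almost Hermitian manifold and fix a local unitary $(1,0)$-frame. Then for all $i,j,k,l\in\{1,\dots,n\}$ $$\begin{aligned}R^L_{i\bar j k\bar l}=&\frac12\left(R_{i\bar l k\bar j}+R_{k\bar j i\bar l}\right)-\frac14\left(\tau_{\bar l\bar\lambda}^{\bar i}\tau_{k\lambda}^j+\tau_{i\lambda}^l\tau_{\bar j\bar\lambda}^{\bar k}-\tau_{ik}^\lambda\tau_{\bar j\bar l}^{\bar\lambda}\right)-\frac12\left(\tau_{k\lambda}^{\bar i}\tau_{\bar j\bar l}^\lambda+\tau_{ik}^{\bar\lambda}\tau_{\bar l\bar\lambda}^j\right)\\&+\frac14\left(\tau_{ik}^{\bar\lambda}+\tau_{k\lambda}^{\bar i}-\tau_{\lambda i}^{\bar k}\right)\left(\tau_{\bar j\bar l}^\lambda+\tau_{\bar l\bar\lambda}^j-\tau_{\bar\lambda\bar j}^l\right).\end{aligned}$$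
   Context: An almost Hermitian manifold $(M,J,g)$ is a manifold $M$ of real dimension $2n$ with an almost complex structure $J$ and a Riemannian metric $g$ satisfying $g(JX,JY)=g(X,Y)$. Write $\langle\cdot,\cdot\rangle$ for the complex bilinear extension of $g$ to $TM\otimes\mathbb C$. The torsion of a connection $\nabla$ is $\tau(X,Y)=\nabla_XY-\nabla_YX-[X,Y]$. The canonical connection $\nabla$ is the unique connection with $\nabla g=0$, $\nabla J=0$ and $\tau(X,\overline Y)=0$ for all $(1,0)$-vectors $X,Y$ (tensors and connections are extended complex linearly); $\tau$ denotes its torsion and $R$ its curvature tensor, with $R(X,Y)Z=\nabla_X\nabla_YZ-\nabla_Y\nabla_XZ-\nabla_{[X,Y]}Z$ and $R(X,Y,Z,W)=\langle R(Z,W)X,Y\rangle$. $R^L$ denotes the curvature tensor of the Levi-Civita connection, with the same conventions. A local unitary $(1,0)$-frame $(e_1,\dots,e_n)$ is a local frame of $T^{1,0}M$ with $\langle e_i,\overline{e_j}\rangle=\delta_{ij}$; $e_{\bar i}=\overline{e_i}$. For $A,B,C,D\in\{1,\bar1,\dots,n,\bar n\}$: $R_{ABCD}=R(e_A,e_B,e_C,e_D)$, $R^L_{ABCD}=R^L(e_A,e_B,e_C,e_D)$, $\tau(e_A,e_B)=\sum_C\tau_{AB}^Ce_C$. A Greek index $\lambda$ occurring in a product is summed over $1,\dots,n$. *)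

theory Defs
  imports "HOL-Analysis.Analysis"
begin

section \<open>Smooth manifolds\<close>

text \<open>Both predicates are only meant for open \<open>S\<close>.\<close>

primrec Ck_on :: "nat \<Rightarrow> 'e::real_normed_vector set \<Rightarrow> ('e \<Rightarrow> 'f::real_normed_vector) \<Rightarrow> bool" where
  "Ck_on 0 S f \<longleftrightarrow> continuous_on S f"
| "Ck_on (Suc k) S f \<longleftrightarrow>
     (\<forall>x\<in>S. f differentiable (at x)) \<and> (\<forall>v. Ck_on k S (\<lambda>x. frechet_derivative f (at x) v))"

definition smooth_on :: "'e::real_normed_vector set \<Rightarrow> ('e \<Rightarrow> 'f::real_normed_vector) \<Rightarrow> bool" where
  "smooth_on S f \<longleftrightarrow> (\<forall>k. Ck_on k S f)"

text \<open>The underlying set of the manifold is \<open>topspace M\<close>; a chart is a pair of its domain and the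
  coordinate map, whose values outside the domain are irrelevant.\<close>

type_synonym ('a, 'e) atlas = "('a set \<times> ('a \<Rightarrow> 'e)) set"

definition smooth_manifold :: "'a topology \<Rightarrow> ('a, 'e::euclidean_space) atlas \<Rightarrow> bool" where
  "smooth_manifold M \<A> \<longleftrightarrow>
     Hausdorff_space M \<and> second_countable M \<and>
     (\<Union>(U, \<phi>)\<in>\<A>. U) = topspace M \<and>
     (\<forall>(U, \<phi>)\<in>\<A>. openin M U \<and> open (\<phi> ` U) \<and>
        homeomorphic_map (subtopology M U) (top_of_set (\<phi> ` U)) \<phi>) \<and>
     (\<forall>(U, \<phi>)\<in>\<A>. \<forall>(V, \<psi>)\<in>\<A>. smooth_on (\<phi> ` (U \<inter> V)) (\<psi> \<circ> inv_into U \<phi>))"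

definition smooth_fun :: "('a, 'e::euclidean_space) atlas \<Rightarrow> 'a set \<Rightarrow> ('a \<Rightarrow> real) \<Rightarrow> bool" where
  "smooth_fun \<A> W f \<longleftrightarrow> (\<forall>(U, \<phi>)\<in>\<A>. smooth_on (\<phi> ` (U \<inter> W)) (f \<circ> inv_into U \<phi>))"

definition smooth_at ::
    "'a topology \<Rightarrow> ('a, 'e::euclidean_space) atlas \<Rightarrow> 'a \<Rightarrow> ('a \<Rightarrow> real) \<Rightarrow> bool" where
  "smooth_at M \<A> p f \<longleftrightarrow> (\<exists>W. openin M W \<and> p \<in> W \<and> smooth_fun \<A> W f)"

section \<open>Tangent vectors and vector fields\<close>

text \<open>Tangent vectors at \<open>p\<close> are the derivations at \<open>p\<close> of germs of real smooth functions. So that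
  equality of tangent vectors is equality of HOL functions, a derivation is set to \<open>0\<close> on functions
  that are not smooth near \<open>p\<close>. The complexified tangent space consists of the complex-valued
  derivations of real germs, i.e. of the \<open>u + \<i> v\<close> with \<open>u\<close>, \<open>v\<close> real tangent vectors.\<close>

type_synonym 'a tvec = "('a \<Rightarrow> real) \<Rightarrow> real"
type_synonym 'a ctvec = "('a \<Rightarrow> real) \<Rightarrow> complex"
type_synonym 'a vfield = "'a \<Rightarrow> 'a tvec"
type_synonym 'a cvfield = "'a \<Rightarrow> 'a ctvec"

definition tangent_space ::
    "'a topology \<Rightarrow> ('a, 'e::euclidean_space) atlas \<Rightarrow> 'a \<Rightarrow> 'a tvec set" where
  "tangent_space M \<A> p = {v.
     (\<forall>f. \<not> smooth_at M \<A> p f \<longrightarrow> v f = 0) \<and>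
     (\<forall>f h W. smooth_at M \<A> p f \<and> openin M W \<and> p \<in> W \<and> (\<forall>q\<in>W. f q = h q) \<longrightarrow> v f = v h) \<and>
     (\<forall>f h a b. smooth_at M \<A> p f \<and> smooth_at M \<A> p h \<longrightarrow>
        v (\<lambda>q. a * f q + b * h q) = a * v f + b * v h) \<and>
     (\<forall>f h. smooth_at M \<A> p f \<and> smooth_at M \<A> p h \<longrightarrow>
        v (\<lambda>q. f q * h q) = v f * h p + f p * v h)}"

definition smooth_vfield ::
    "'a topology \<Rightarrow> ('a, 'e::euclidean_space) atlas \<Rightarrow> 'a set \<Rightarrow> 'a vfield \<Rightarrow> bool" where
  "smooth_vfield M \<A> W X \<longleftrightarrow>
     (\<forall>p\<in>W. X p \<in> tangent_space M \<A> p) \<and>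
     (\<forall>V f. openin M V \<and> V \<subseteq> W \<and> smooth_fun \<A> V f \<longrightarrow> smooth_fun \<A> V (\<lambda>p. X p f))"

definition smooth_vfield_at ::
    "'a topology \<Rightarrow> ('a, 'e::euclidean_space) atlas \<Rightarrow> 'a \<Rightarrow> 'a vfield \<Rightarrow> bool" where
  "smooth_vfield_at M \<A> p X \<longleftrightarrow> (\<exists>W. openin M W \<and> p \<in> W \<and> smooth_vfield M \<A> W X)"

definition bracket ::
    "'a topology \<Rightarrow> ('a, 'e::euclidean_space) atlas \<Rightarrow> 'a vfield \<Rightarrow> 'a vfield \<Rightarrow> 'a vfield" where
  "bracket M \<A> X Y = (\<lambda>p f. if smooth_at M \<A> p f
     then X p (\<lambda>q. Y q f) - Y p (\<lambda>q. X q f) else 0)"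

section \<open>Complex linear extensions\<close>

definition re_vec :: "'a ctvec \<Rightarrow> 'a tvec" where "re_vec v = (\<lambda>f. Re (v f))"
definition im_vec :: "'a ctvec \<Rightarrow> 'a tvec" where "im_vec v = (\<lambda>f. Im (v f))"
definition re_fld :: "'a cvfield \<Rightarrow> 'a vfield" where "re_fld X = (\<lambda>p. re_vec (X p))"
definition im_fld :: "'a cvfield \<Rightarrow> 'a vfield" where "im_fld X = (\<lambda>p. im_vec (X p))"
definition cnj_fld :: "'a cvfield \<Rightarrow> 'a cvfield" where "cnj_fld X = (\<lambda>p f. cnj (X p f))"

definition ctangent_space ::
    "'a topology \<Rightarrow> ('a, 'e::euclidean_space) atlas \<Rightarrow> 'a \<Rightarrow> 'a ctvec set" where
  "ctangent_space M \<A> p = {v. re_vec v \<in> tangent_space M \<A> p \<and> im_vec v \<in> tangent_space M \<A> p}"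

definition smooth_cvfield ::
    "'a topology \<Rightarrow> ('a, 'e::euclidean_space) atlas \<Rightarrow> 'a set \<Rightarrow> 'a cvfield \<Rightarrow> bool" where
  "smooth_cvfield M \<A> W X \<longleftrightarrow> smooth_vfield M \<A> W (re_fld X) \<and> smooth_vfield M \<A> W (im_fld X)"

text \<open>A field \<open>J\<close> of endomorphisms and a field \<open>g\<close> of bilinear forms, at a point:\<close>

definition clin :: "('a \<Rightarrow> 'a tvec \<Rightarrow> 'a tvec) \<Rightarrow> 'a \<Rightarrow> 'a ctvec \<Rightarrow> 'a ctvec" where
  "clin J p v = (\<lambda>f. Complex (J p (re_vec v) f) (J p (im_vec v) f))"

definition cform :: "('a \<Rightarrow> 'a tvec \<Rightarrow> 'a tvec \<Rightarrow> real) \<Rightarrow> 'a \<Rightarrow> 'a ctvec \<Rightarrow> 'a ctvec \<Rightarrow> complex" where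
  "cform g p u v = Complex
     (g p (re_vec u) (re_vec v) - g p (im_vec u) (im_vec v))
     (g p (re_vec u) (im_vec v) + g p (im_vec u) (re_vec v))"

text \<open>A real bilinear operation \<open>B\<close> on vector fields (covariant derivative, Lie bracket):\<close>

definition cbilin ::
    "('a vfield \<Rightarrow> 'a vfield \<Rightarrow> 'a vfield) \<Rightarrow> 'a cvfield \<Rightarrow> 'a cvfield \<Rightarrow> 'a cvfield" where
  "cbilin B X Y = (\<lambda>p f. Complex
     (B (re_fld X) (re_fld Y) p f - B (im_fld X) (im_fld Y) p f)
     (B (re_fld X) (im_fld Y) p f + B (im_fld X) (re_fld Y) p f))"

section \<open>Almost Hermitian manifolds\<close>

definition almost_complex_structure ::
    "'a topology \<Rightarrow> ('a, 'e::euclidean_space) atlas \<Rightarrow> ('a \<Rightarrow> 'a tvec \<Rightarrow> 'a tvec) \<Rightarrow> bool" where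
  "almost_complex_structure M \<A> J \<longleftrightarrow>
     (\<forall>p\<in>topspace M. \<forall>u\<in>tangent_space M \<A> p. \<forall>v\<in>tangent_space M \<A> p.
        J p u \<in> tangent_space M \<A> p \<and>
        (\<forall>a b. J p (\<lambda>f. a * u f + b * v f) = (\<lambda>f. a * J p u f + b * J p v f)) \<and>
        J p (J p u) = (\<lambda>f. - u f)) \<and>
     (\<forall>W X. openin M W \<and> smooth_vfield M \<A> W X \<longrightarrow> smooth_vfield M \<A> W (\<lambda>p. J p (X p)))"

definition riemannian_metric ::
    "'a topology \<Rightarrow> ('a, 'e::euclidean_space) atlas \<Rightarrow> ('a \<Rightarrow> 'a tvec \<Rightarrow> 'a tvec \<Rightarrow> real) \<Rightarrow> bool" where
  "riemannian_metric M \<A> g \<longleftrightarrow>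
     (\<forall>p\<in>topspace M. \<forall>u\<in>tangent_space M \<A> p. \<forall>v\<in>tangent_space M \<A> p.
        g p u v = g p v u \<and>
        (\<forall>w\<in>tangent_space M \<A> p. \<forall>a b.
           g p (\<lambda>f. a * u f + b * v f) w = a * g p u w + b * g p v w) \<and>
        (u \<noteq> (\<lambda>_. 0) \<longrightarrow> g p u u > 0)) \<and>
     (\<forall>W X Y. openin M W \<and> smooth_vfield M \<A> W X \<and> smooth_vfield M \<A> W Y \<longrightarrow>
        smooth_fun \<A> W (\<lambda>p. g p (X p) (Y p)))"

definition almost_hermitian_manifold ::
    "'a topology \<Rightarrow> ('a, 'e::euclidean_space) atlas \<Rightarrow> ('a \<Rightarrow> 'a tvec \<Rightarrow> 'a tvec) \<Rightarrow>
     ('a \<Rightarrow> 'a tvec \<Rightarrow> 'a tvec \<Rightarrow> real) \<Rightarrow> bool" where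
  "almost_hermitian_manifold M \<A> J g \<longleftrightarrow>
     smooth_manifold M \<A> \<and> almost_complex_structure M \<A> J \<and> riemannian_metric M \<A> g \<and>
     (\<forall>p\<in>topspace M. \<forall>u\<in>tangent_space M \<A> p. \<forall>v\<in>tangent_space M \<A> p.
        g p (J p u) (J p v) = g p u v)"

text \<open>\<open>(1,0)\<close>-vectors: the \<open>\<i>\<close>-eigenspace of \<open>J\<close>\<close>

definition T10 ::
    "'a topology \<Rightarrow> ('a, 'e::euclidean_space) atlas \<Rightarrow> ('a \<Rightarrow> 'a tvec \<Rightarrow> 'a tvec) \<Rightarrow>
     'a \<Rightarrow> 'a ctvec set" where
  "T10 M \<A> J p = {v \<in> ctangent_space M \<A> p. clin J p v = (\<lambda>f. \<i> * v f)}"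

section \<open>Connections, torsion and curvature\<close>

text \<open>\<open>nabla p v Y\<close> is the derivative at \<open>p\<close>, in the direction of the tangent vector \<open>v\<close> at \<open>p\<close>, of
  a vector field \<open>Y\<close> defined near \<open>p\<close>; it depends only on the germ of \<open>Y\<close> at \<open>p\<close>, so that the
  connection acts on vector fields over any open subset.\<close>

type_synonym 'a conn = "'a \<Rightarrow> 'a tvec \<Rightarrow> 'a vfield \<Rightarrow> 'a tvec"

definition cov :: "'a conn \<Rightarrow> 'a vfield \<Rightarrow> 'a vfield \<Rightarrow> 'a vfield" where
  "cov nabla X Y = (\<lambda>p. nabla p (X p) Y)"

definition connection ::
    "'a topology \<Rightarrow> ('a, 'e::euclidean_space) atlas \<Rightarrow> 'a conn \<Rightarrow> bool" where
  "connection M \<A> nabla \<longleftrightarrow>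
     (\<forall>p\<in>topspace M. \<forall>u\<in>tangent_space M \<A> p. \<forall>v\<in>tangent_space M \<A> p.
      \<forall>Y. smooth_vfield_at M \<A> p Y \<longrightarrow>
        nabla p v Y \<in> tangent_space M \<A> p \<and>
        (\<forall>a b. nabla p (\<lambda>f. a * u f + b * v f) Y = (\<lambda>f. a * nabla p u Y f + b * nabla p v Y f)) \<and>
        (\<forall>Z. smooth_vfield_at M \<A> p Z \<longrightarrow>
           nabla p v (\<lambda>q f. Y q f + Z q f) = (\<lambda>f. nabla p v Y f + nabla p v Z f)) \<and>
        (\<forall>h. smooth_at M \<A> p h \<longrightarrow>
           nabla p v (\<lambda>q f. h q * Y q f) = (\<lambda>f. v h * Y p f + h p * nabla p v Y f)) \<and>
        (\<forall>Z W. openin M W \<and> p \<in> W \<and> (\<forall>q\<in>W. Y q = Z q) \<longrightarrow> nabla p v Y = nabla p v Z)) \<and>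
     (\<forall>W X Y. openin M W \<and> smooth_vfield M \<A> W X \<and> smooth_vfield M \<A> W Y \<longrightarrow>
        smooth_vfield M \<A> W (cov nabla X Y))"

definition metric_connection ::
    "'a topology \<Rightarrow> ('a, 'e::euclidean_space) atlas \<Rightarrow> ('a \<Rightarrow> 'a tvec \<Rightarrow> 'a tvec \<Rightarrow> real) \<Rightarrow>
     'a conn \<Rightarrow> bool" where
  "metric_connection M \<A> g nabla \<longleftrightarrow>
     (\<forall>p\<in>topspace M. \<forall>v\<in>tangent_space M \<A> p. \<forall>Y Z.
        smooth_vfield_at M \<A> p Y \<and> smooth_vfield_at M \<A> p Z \<longrightarrow>
        v (\<lambda>q. g q (Y q) (Z q)) = g p (nabla p v Y) (Z p) + g p (Y p) (nabla p v Z))"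

definition almost_complex_connection ::
    "'a topology \<Rightarrow> ('a, 'e::euclidean_space) atlas \<Rightarrow> ('a \<Rightarrow> 'a tvec \<Rightarrow> 'a tvec) \<Rightarrow>
     'a conn \<Rightarrow> bool" where
  "almost_complex_connection M \<A> J nabla \<longleftrightarrow>
     (\<forall>p\<in>topspace M. \<forall>v\<in>tangent_space M \<A> p. \<forall>Y. smooth_vfield_at M \<A> p Y \<longrightarrow>
        nabla p v (\<lambda>q. J q (Y q)) = J p (nabla p v Y))"

text \<open>The formulas for torsion and curvature in terms of a covariant derivative \<open>D\<close> and a bracket
  \<open>br\<close>, used both for real fields and, with the extended operations, for complex fields.\<close>

definition torsion_of where
  "torsion_of D br X Y = (\<lambda>p (f :: 'a \<Rightarrow> real). D X Y p f - D Y X p f - br X Y p f)"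
  for D br :: "('a \<Rightarrow> ('a \<Rightarrow> real) \<Rightarrow> 'k::ab_group_add) \<Rightarrow> ('a \<Rightarrow> ('a \<Rightarrow> real) \<Rightarrow> 'k) \<Rightarrow> 'a \<Rightarrow> ('a \<Rightarrow> real) \<Rightarrow> 'k"

definition curvature_of where
  "curvature_of D br X Y Z = (\<lambda>p (f :: 'a \<Rightarrow> real). D X (D Y Z) p f - D Y (D X Z) p f - D (br X Y) Z p f)"
  for D br :: "('a \<Rightarrow> ('a \<Rightarrow> real) \<Rightarrow> 'k::ab_group_add) \<Rightarrow> ('a \<Rightarrow> ('a \<Rightarrow> real) \<Rightarrow> 'k) \<Rightarrow> 'a \<Rightarrow> ('a \<Rightarrow> real) \<Rightarrow> 'k"

definition torsion ::
    "'a topology \<Rightarrow> ('a, 'e::euclidean_space) atlas \<Rightarrow> 'a conn \<Rightarrow> 'a vfield \<Rightarrow> 'a vfield \<Rightarrow> 'a vfield" where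
  "torsion M \<A> nabla = torsion_of (cov nabla) (bracket M \<A>)"

definition ctorsion ::
    "'a topology \<Rightarrow> ('a, 'e::euclidean_space) atlas \<Rightarrow> 'a conn \<Rightarrow> 'a cvfield \<Rightarrow> 'a cvfield \<Rightarrow> 'a cvfield" where
  "ctorsion M \<A> nabla = torsion_of (cbilin (cov nabla)) (cbilin (bracket M \<A>))"

definition ccurvature ::
    "'a topology \<Rightarrow> ('a, 'e::euclidean_space) atlas \<Rightarrow> 'a conn \<Rightarrow>
     'a cvfield \<Rightarrow> 'a cvfield \<Rightarrow> 'a cvfield \<Rightarrow> 'a cvfield" where
  "ccurvature M \<A> nabla = curvature_of (cbilin (cov nabla)) (cbilin (bracket M \<A>))"

text \<open>Note the order of the arguments: \<open>R(X,Y,Z,W) = \<langle>R(Z,W)X, Y\<rangle>\<close>.\<close>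

definition curvature4 ::
    "'a topology \<Rightarrow> ('a, 'e::euclidean_space) atlas \<Rightarrow> ('a \<Rightarrow> 'a tvec \<Rightarrow> 'a tvec \<Rightarrow> real) \<Rightarrow> 'a conn \<Rightarrow>
     'a cvfield \<Rightarrow> 'a cvfield \<Rightarrow> 'a cvfield \<Rightarrow> 'a cvfield \<Rightarrow> 'a \<Rightarrow> complex" where
  "curvature4 M \<A> g nabla X Y Z W p = cform g p (ccurvature M \<A> nabla Z W X p) (Y p)"

definition levi_civita_connection ::
    "'a topology \<Rightarrow> ('a, 'e::euclidean_space) atlas \<Rightarrow> ('a \<Rightarrow> 'a tvec \<Rightarrow> 'a tvec \<Rightarrow> real) \<Rightarrow>
     'a conn \<Rightarrow> bool" where
  "levi_civita_connection M \<A> g nabla \<longleftrightarrow>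
     connection M \<A> nabla \<and> metric_connection M \<A> g nabla \<and>
     (\<forall>W X Y. openin M W \<and> smooth_vfield M \<A> W X \<and> smooth_vfield M \<A> W Y \<longrightarrow>
        (\<forall>p\<in>W. torsion M \<A> nabla X Y p = (\<lambda>_. 0)))"

text \<open>Since the torsion is tensorial, its vanishing on the pairs \<open>X\<close>, \<open>cnj Y\<close> of \<open>(1,0)\<close>-vectors
  \<open>X\<close>, \<open>Y\<close> is expressed by means of local \<open>(1,0)\<close>-fields.\<close>

definition canonical_connection ::
    "'a topology \<Rightarrow> ('a, 'e::euclidean_space) atlas \<Rightarrow> ('a \<Rightarrow> 'a tvec \<Rightarrow> 'a tvec) \<Rightarrow>
     ('a \<Rightarrow> 'a tvec \<Rightarrow> 'a tvec \<Rightarrow> real) \<Rightarrow> 'a conn \<Rightarrow> bool" where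
  "canonical_connection M \<A> J g nabla \<longleftrightarrow>
     connection M \<A> nabla \<and> metric_connection M \<A> g nabla \<and> almost_complex_connection M \<A> J nabla \<and>
     (\<forall>W X Y. openin M W \<and> smooth_cvfield M \<A> W X \<and> smooth_cvfield M \<A> W Y \<and>
        (\<forall>p\<in>W. X p \<in> T10 M \<A> J p \<and> Y p \<in> T10 M \<A> J p) \<longrightarrow>
        (\<forall>p\<in>W. ctorsion M \<A> nabla X (cnj_fld Y) p = (\<lambda>_. 0)))"

section \<open>Local unitary frames\<close>

definition unitary_frame ::
    "'a topology \<Rightarrow> ('a, 'e::euclidean_space) atlas \<Rightarrow> ('a \<Rightarrow> 'a tvec \<Rightarrow> 'a tvec) \<Rightarrow>
     ('a \<Rightarrow> 'a tvec \<Rightarrow> 'a tvec \<Rightarrow> real) \<Rightarrow> 'a set \<Rightarrow> ('n::finite \<Rightarrow> 'a cvfield) \<Rightarrow> bool" where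
  "unitary_frame M \<A> J g U e \<longleftrightarrow>
     openin M U \<and> (\<forall>i. smooth_cvfield M \<A> U (e i)) \<and>
     (\<forall>p\<in>U. (\<forall>i. e i p \<in> T10 M \<A> J p) \<and>
        (\<forall>v\<in>T10 M \<A> J p. \<exists>!c :: 'n \<Rightarrow> complex. v = (\<lambda>f. \<Sum>i\<in>UNIV. c i * e i p f)) \<and>
        (\<forall>i j. cform g p (e i p) (cnj_fld (e j) p) = (if i = j then 1 else 0)))"

text \<open>The index set \<open>{1, bar 1, \<dots>, n, bar n}\<close> is the sum type \<open>'n + 'n\<close>.\<close>

abbreviation hol :: "'n \<Rightarrow> 'n + 'n" where "hol \<equiv> Inl"
abbreviation bar :: "'n \<Rightarrow> 'n + 'n" where "bar \<equiv> Inr"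

definition full_frame :: "('n \<Rightarrow> 'a cvfield) \<Rightarrow> 'n + 'n \<Rightarrow> 'a cvfield" where
  "full_frame e = case_sum e (\<lambda>i. cnj_fld (e i))"

definition frame_curvature ::
    "'a topology \<Rightarrow> ('a, 'e::euclidean_space) atlas \<Rightarrow> ('a \<Rightarrow> 'a tvec \<Rightarrow> 'a tvec \<Rightarrow> real) \<Rightarrow> 'a conn \<Rightarrow>
     ('n \<Rightarrow> 'a cvfield) \<Rightarrow> 'a \<Rightarrow> 'n + 'n \<Rightarrow> 'n + 'n \<Rightarrow> 'n + 'n \<Rightarrow> 'n + 'n \<Rightarrow> complex" where
  "frame_curvature M \<A> g nabla e p a b c d =
     curvature4 M \<A> g nabla (full_frame e a) (full_frame e b) (full_frame e c) (full_frame e d) p"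

end

(* Write D = nabla + A for the Levi-Civita connection D and the canonical connection nabla. Both are
   metric and D is torsion free, so with t(X,Y,Z) = <tau(X,Y),Z>
     2 <A(X,Y),Z> = - t(X,Y,Z) + t(Y,Z,X) - t(Z,X,Y).
   For X, Z of type (1,0) and Y, W of type (0,1) this turns <R^L(X,Y)Z,W> into <R(X,Y)Z,W> plus the
   covariant derivatives of t along X and Y and the quadratic terms - <A(Y,Z),A(X,W)> + <A(X,Z),A(Y,W)>.
   Since nabla preserves types and tau vanishes on mixed types, the first Bianchi identity for
   (X,Y,Z) and for (Y,X,W) expresses these derivatives of t by R and by tau(tau(.,.),.). The terms
   <R(X,Y)Z,W> cancel, and expanding the quadratic terms in the frame gives the formula. *)

theory Submission
  imports Defs "HOL-Library.Function_Algebras"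
begin

section \<open>Two connections on a module of vector fields\<close>

text \<open>The module separates algebra from analysis: its identities are plain equalities between
  fields or functions, so the curvature computation takes place in a ring, and the geometry only has
  to verify the axioms. The types are indexed by a Boolean, so that conjugating an identity means
  negating \<open>b\<close>; the second Bianchi identity is the first with the types exchanged. Why
  the terms <R(X,Y)Z,W> cancel: in the cyclic sum for X, Y, Z the term <R(Z,X)Y,W> is 0, because R
  preserves types and two fields of the same type are orthogonal. Since T(X,Y) = T(Y,Z) = 0, the
  only derivative of torsion left is that of T(Z,X) along Y. So each Bianchi identity trades one
  derivative for <R(X,Y)Z,W>, which by the symmetries of R is the same in both, minus one of the two
  curvature terms of the result. Each A carries a factor 1/2, hence the factor 4 in the quadratic
  terms.\<close>

text \<open>\<open>V\<close> stands for the complex vector fields and \<open>F\<close> for the complex functions on the domain of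
  the frame, \<open>sc\<close> for multiplication by functions, \<open>act\<close> for the derivative of functions along
  fields, \<open>br\<close> for the Lie bracket, \<open>G\<close> for \<open>\<langle>\<cdot>,\<cdot>\<rangle>\<close>, \<open>N\<close> and \<open>D\<close> for the canonical and the
  Levi-Civita connection, \<open>H True\<close> and \<open>H False\<close> for the \<open>(1,0)\<close>- and \<open>(0,1)\<close>-fields, and \<open>e\<close>,
  \<open>eb\<close> for the frame and its conjugate. As \<open>F\<close> is only a ring, identities are stated with
  denominators cleared.\<close>

locale torsion_calculus =
  fixes V :: "'v::ab_group_add set" and F :: "'f::comm_ring_1 set"
    and sc :: "'f \<Rightarrow> 'v \<Rightarrow> 'v" and act :: "'v \<Rightarrow> 'f \<Rightarrow> 'f" and br :: "'v \<Rightarrow> 'v \<Rightarrow> 'v"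
    and G :: "'v \<Rightarrow> 'v \<Rightarrow> 'f" and N D :: "'v \<Rightarrow> 'v \<Rightarrow> 'v" and H :: "bool \<Rightarrow> 'v set"
    and e eb :: "'i::finite \<Rightarrow> 'v"
  assumes V_zero: "0 \<in> V"
    and V_diff: "X \<in> V \<Longrightarrow> Y \<in> V \<Longrightarrow> X - Y \<in> V"
    and V_sc: "h \<in> F \<Longrightarrow> X \<in> V \<Longrightarrow> sc h X \<in> V"
    and V_br: "X \<in> V \<Longrightarrow> Y \<in> V \<Longrightarrow> br X Y \<in> V"
    and V_N: "X \<in> V \<Longrightarrow> Y \<in> V \<Longrightarrow> N X Y \<in> V"
    and V_D: "X \<in> V \<Longrightarrow> Y \<in> V \<Longrightarrow> D X Y \<in> V"
    and F_G: "X \<in> V \<Longrightarrow> Y \<in> V \<Longrightarrow> G X Y \<in> F"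
    and G_sym: "X \<in> V \<Longrightarrow> Y \<in> V \<Longrightarrow> G X Y = G Y X"
    and G_add: "X \<in> V \<Longrightarrow> Y \<in> V \<Longrightarrow> Z \<in> V \<Longrightarrow> G (X + Y) Z = G X Z + G Y Z"
    and G_sc: "h \<in> F \<Longrightarrow> X \<in> V \<Longrightarrow> Y \<in> V \<Longrightarrow> G (sc h X) Y = h * G X Y"
    and N_add1: "X \<in> V \<Longrightarrow> Y \<in> V \<Longrightarrow> Z \<in> V \<Longrightarrow> N (X + Y) Z = N X Z + N Y Z"
    and N_add2: "X \<in> V \<Longrightarrow> Y \<in> V \<Longrightarrow> Z \<in> V \<Longrightarrow> N X (Y + Z) = N X Y + N X Z"
    and br_add2: "X \<in> V \<Longrightarrow> Y \<in> V \<Longrightarrow> Z \<in> V \<Longrightarrow> br X (Y + Z) = br X Y + br X Z"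
    and br_anti: "X \<in> V \<Longrightarrow> Y \<in> V \<Longrightarrow> br Y X = - br X Y"
    and jacobi: "X \<in> V \<Longrightarrow> Y \<in> V \<Longrightarrow> Z \<in> V \<Longrightarrow>
       br X (br Y Z) + br Y (br Z X) + br Z (br X Y) = 0"
    and torsion_sc: "h \<in> F \<Longrightarrow> X \<in> V \<Longrightarrow> Y \<in> V \<Longrightarrow>
       N X (sc h Y) - N (sc h Y) X - br X (sc h Y) = sc h (N X Y - N Y X - br X Y)"
    and act_add: "X \<in> V \<Longrightarrow> f \<in> F \<Longrightarrow> h \<in> F \<Longrightarrow> act X (f + h) = act X f + act X h"
    and act_br: "X \<in> V \<Longrightarrow> Y \<in> V \<Longrightarrow> h \<in> F \<Longrightarrow>
       act (br X Y) h = act X (act Y h) - act Y (act X h)"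
    and N_metric: "X \<in> V \<Longrightarrow> Y \<in> V \<Longrightarrow> Z \<in> V \<Longrightarrow> act X (G Y Z) = G (N X Y) Z + G Y (N X Z)"
    and D_metric: "X \<in> V \<Longrightarrow> Y \<in> V \<Longrightarrow> Z \<in> V \<Longrightarrow> act X (G Y Z) = G (D X Y) Z + G Y (D X Z)"
    and D_torsion: "X \<in> V \<Longrightarrow> Y \<in> V \<Longrightarrow> D X Y - D Y X = br X Y"
    and H_V: "X \<in> H b \<Longrightarrow> X \<in> V"
    and N_H: "X \<in> V \<Longrightarrow> Y \<in> H b \<Longrightarrow> N X Y \<in> H b"
    and G_H: "X \<in> H b \<Longrightarrow> Y \<in> H b \<Longrightarrow> G X Y = 0"
    and torsion_H: "X \<in> H b \<Longrightarrow> Y \<in> H (\<not> b) \<Longrightarrow> N X Y - N Y X = br X Y"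
    and e_H: "e m \<in> H True" and eb_H: "eb m \<in> H False"
    and frame: "X \<in> V \<Longrightarrow> X = (\<Sum>m\<in>UNIV. sc (G X (eb m)) (e m) + sc (G X (e m)) (eb m))"
begin

section \<open>Closure and additivity\<close>

lemma V_uminus: "X \<in> V \<Longrightarrow> - X \<in> V"
  using V_diff[OF V_zero, of X] by simp

lemma V_add: "X \<in> V \<Longrightarrow> Y \<in> V \<Longrightarrow> X + Y \<in> V"
  using V_diff[of X "- Y"] V_uminus[of Y] by simp

lemma V_sum: "(\<And>m. m \<in> I \<Longrightarrow> f m \<in> V) \<Longrightarrow> (\<Sum>m\<in>I. f m) \<in> V"
  by (induction I rule: infinite_finite_induct) (auto simp: V_zero V_add)

lemmas V_frame = H_V[OF e_H] H_V[OF eb_H]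
lemmas V_intros = V_zero V_diff V_sc V_br V_N V_D V_uminus V_add V_frame

lemma additive_diff:
  assumes "\<And>Y Z. Y \<in> V \<Longrightarrow> Z \<in> V \<Longrightarrow> f (Y + Z) = f Y + f Z" "X \<in> V" "Y \<in> V"
  shows "f (X - Y) = f X - (f Y :: 'w::ab_group_add)"
  using assms(1)[of "X - Y" Y] assms(2,3) by (simp add: V_diff)

lemma additive_sum:
  assumes "\<And>Y Z. Y \<in> V \<Longrightarrow> Z \<in> V \<Longrightarrow> f (Y + Z) = f Y + f Z" "\<And>m. m \<in> I \<Longrightarrow> u m \<in> V"
  shows "f (\<Sum>m\<in>I. u m) = (\<Sum>m\<in>I. f (u m) :: 'w::ab_group_add)"
proof -
  have "f 0 = 0"
    using additive_diff[of f 0 0, OF assms(1)] by (simp add: V_zero)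
  then show ?thesis
    using assms(2) by (induction I rule: infinite_finite_induct) (auto simp: assms(1) V_sum)
qed

lemma G_add2: "X \<in> V \<Longrightarrow> Y \<in> V \<Longrightarrow> Z \<in> V \<Longrightarrow> G X (Y + Z) = G X Y + G X Z"
  by (simp add: G_sym[of X] G_add V_add)

lemma G_diff: "X \<in> V \<Longrightarrow> Y \<in> V \<Longrightarrow> Z \<in> V \<Longrightarrow> G (X - Y) Z = G X Z - G Y Z"
  by (rule additive_diff[where f = "\<lambda>X. G X Z"]) (simp_all add: G_add)

lemma G_diff2: "X \<in> V \<Longrightarrow> Y \<in> V \<Longrightarrow> Z \<in> V \<Longrightarrow> G X (Y - Z) = G X Y - G X Z"
  by (rule additive_diff[where f = "\<lambda>Y. G X Y"]) (simp_all add: G_add2)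

lemma G_zero: "X \<in> V \<Longrightarrow> G 0 X = 0"
  using G_diff[of 0 0 X] V_zero by simp

lemma G_uminus: "X \<in> V \<Longrightarrow> Z \<in> V \<Longrightarrow> G (- X) Z = - G X Z"
  using G_diff[of 0 X Z] V_zero by (simp add: G_zero)

lemma N_diff1: "X \<in> V \<Longrightarrow> Y \<in> V \<Longrightarrow> Z \<in> V \<Longrightarrow> N (X - Y) Z = N X Z - N Y Z"
  by (rule additive_diff[where f = "\<lambda>X. N X Z"]) (simp_all add: N_add1)

lemma N_uminus1: "X \<in> V \<Longrightarrow> Z \<in> V \<Longrightarrow> N (- X) Z = - N X Z"
  using N_diff1[of X X Z] N_diff1[of 0 X Z] V_zero by (simp add: N_diff1)

section \<open>Torsion, curvatures and the difference of the two connections\<close>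

definition T :: "'v \<Rightarrow> 'v \<Rightarrow> 'v" where "T X Y = N X Y - N Y X - br X Y"
definition t :: "'v \<Rightarrow> 'v \<Rightarrow> 'v \<Rightarrow> 'f" where "t X Y Z = G (T X Y) Z"
definition A :: "'v \<Rightarrow> 'v \<Rightarrow> 'v" where "A X Y = D X Y - N X Y"
definition R :: "'v \<Rightarrow> 'v \<Rightarrow> 'v \<Rightarrow> 'v" where "R X Y Z = N X (N Y Z) - N Y (N X Z) - N (br X Y) Z"
definition RL :: "'v \<Rightarrow> 'v \<Rightarrow> 'v \<Rightarrow> 'v" where "RL X Y Z = D X (D Y Z) - D Y (D X Z) - D (br X Y) Z"

lemma V_T: "X \<in> V \<Longrightarrow> Y \<in> V \<Longrightarrow> T X Y \<in> V"
  by (simp add: T_def V_intros)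

lemma V_R: "X \<in> V \<Longrightarrow> Y \<in> V \<Longrightarrow> Z \<in> V \<Longrightarrow> R X Y Z \<in> V"
  by (simp add: R_def V_intros)

lemma V_A: "X \<in> V \<Longrightarrow> Y \<in> V \<Longrightarrow> A X Y \<in> V"
  by (simp add: A_def V_intros)

lemma T_anti: "X \<in> V \<Longrightarrow> Y \<in> V \<Longrightarrow> T Y X = - T X Y"
  by (simp add: T_def br_anti[of X Y])

lemma T_add2: "X \<in> V \<Longrightarrow> Y \<in> V \<Longrightarrow> Z \<in> V \<Longrightarrow> T X (Y + Z) = T X Y + T X Z"
  by (simp add: T_def N_add1 N_add2 br_add2 algebra_simps)

lemma t_anti: "X \<in> V \<Longrightarrow> Y \<in> V \<Longrightarrow> Z \<in> V \<Longrightarrow> t Y X Z = - t X Y Z"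
  by (simp add: t_def T_anti[of X Y] G_uminus V_T)

lemma t_diff2: "X \<in> V \<Longrightarrow> Y \<in> V \<Longrightarrow> Z \<in> V \<Longrightarrow> W \<in> V \<Longrightarrow> t X (Y - Z) W = t X Y W - t X Z W"
  by (rule additive_diff[where f = "\<lambda>Y. t X Y W"]) (simp_all add: t_def T_add2 G_add V_T)

lemma t_diff1: "X \<in> V \<Longrightarrow> Y \<in> V \<Longrightarrow> Z \<in> V \<Longrightarrow> W \<in> V \<Longrightarrow> t (Y - Z) X W = t Y X W - t Z X W"
  by (simp add: t_anti[of X] t_diff2 V_diff)

lemma T_H: "X \<in> H b \<Longrightarrow> Y \<in> H (\<not> b) \<Longrightarrow> T X Y = 0"
  by (simp add: T_def torsion_H)

lemma t_H: "X \<in> H b \<Longrightarrow> Y \<in> H (\<not> b) \<Longrightarrow> Z \<in> V \<Longrightarrow> t X Y Z = 0"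
  by (simp add: t_def T_H G_zero)

text \<open>Neither \<open>N X\<close> nor \<open>br X\<close> is linear over functions, but their
  Leibniz terms cancel in the torsion. This is \<open>torsion_sc\<close>, which lets the
  coefficients of \<open>frame\<close> be pulled out of \<open>T X\<close>.\<close>

lemma T_frame:
  assumes "X \<in> V" "Y \<in> V"
  shows "T X Y = (\<Sum>m\<in>UNIV. sc (G Y (eb m)) (T X (e m)) + sc (G Y (e m)) (T X (eb m)))"
proof -
  have "T X Y = T X (\<Sum>m\<in>UNIV. sc (G Y (eb m)) (e m) + sc (G Y (e m)) (eb m))"
    using arg_cong[OF frame[OF assms(2)], of "T X"] .
  also have "\<dots> = (\<Sum>m\<in>UNIV. T X (sc (G Y (eb m)) (e m) + sc (G Y (e m)) (eb m)))"
    by (rule additive_sum) (simp_all add: T_add2 assms V_intros F_G)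
  also have "\<dots> = (\<Sum>m\<in>UNIV. sc (G Y (eb m)) (T X (e m)) + sc (G Y (e m)) (T X (eb m)))"
    using torsion_sc[of _ X] by (simp add: T_add2 assms V_intros F_G flip: T_def)
  finally show ?thesis .
qed

lemma G_sum: "(\<And>m. m \<in> I \<Longrightarrow> u m \<in> V) \<Longrightarrow> W \<in> V \<Longrightarrow> G (\<Sum>m\<in>I. u m) W = (\<Sum>m\<in>I. G (u m) W)"
  by (rule additive_sum) (simp_all add: G_add)

lemma t_frame:
  assumes "X \<in> V" "Y \<in> V" "W \<in> V"
  shows "t X Y W = (\<Sum>m\<in>UNIV. G Y (eb m) * t X (e m) W + G Y (e m) * t X (eb m) W)"
  unfolding t_def T_frame[OF assms(1,2)]
  by (subst G_sum) (simp_all add: assms V_intros V_T F_G G_add G_sc)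

text \<open>Pairs the expansion \<open>frame\<close> of \<open>X\<close> with \<open>Y\<close>. This
  is the tool that expands the terms quadratic in \<open>A\<close>.\<close>

lemma G_frame:
  assumes "X \<in> V" "Y \<in> V"
  shows "G X Y = (\<Sum>m\<in>UNIV. G X (eb m) * G Y (e m) + G X (e m) * G Y (eb m))"
proof -
  have "G X Y = G (\<Sum>m\<in>UNIV. sc (G X (eb m)) (e m) + sc (G X (e m)) (eb m)) Y"
    using arg_cong[OF frame[OF assms(1)], of "\<lambda>X. G X Y"] .
  also have "\<dots> = (\<Sum>m\<in>UNIV. G (sc (G X (eb m)) (e m) + sc (G X (e m)) (eb m)) Y)"
    by (rule G_sum) (simp_all add: assms V_intros F_G)
  also have "\<dots> = (\<Sum>m\<in>UNIV. G X (eb m) * G Y (e m) + G X (e m) * G Y (eb m))"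
    by (simp add: G_add G_sc assms V_intros F_G G_sym[of Y])
  finally show ?thesis .
qed

text \<open>Both connections are metric, so the derivative \<open>act X (G Y Z)\<close> drops out of
  the difference of \<open>D_metric\<close> and \<open>N_metric\<close>.\<close>

lemma A_skew:
  assumes "X \<in> V" "Y \<in> V" "Z \<in> V"
  shows "G (A X Y) Z = - G (A X Z) Y"
proof -
  have "G (A X Y) Z + G (A X Z) Y = (G (D X Y) Z + G Y (D X Z)) - (G (N X Y) Z + G Y (N X Z))"
    using assms by (simp add: A_def G_diff V_intros G_sym[of Y])
  then show ?thesis
    using N_metric[OF assms] D_metric[OF assms] by (simp add: eq_neg_iff_add_eq_0)
qed

lemma A_torsion: "X \<in> V \<Longrightarrow> Y \<in> V \<Longrightarrow> A X Y = A Y X - T X Y"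
  using D_torsion[of X Y] by (simp add: A_def T_def algebra_simps)

text \<open>The argument of the Koszul formula: a trilinear form that is skew in its last two
  arguments is determined by its antisymmetrization in the first two, which for \<open>A\<close> is
  minus the torsion of \<open>N\<close> because \<open>D\<close> has none.\<close>

lemma A_eq:
  assumes "X \<in> V" "Y \<in> V" "Z \<in> V"
  shows "2 * G (A X Y) Z = - t X Y Z + t Y Z X - t Z X Y"
proof -
  have *: "G (A X Y) Z = G (A Y X) Z - t X Y Z" if "X \<in> V" "Y \<in> V" "Z \<in> V" for X Y Z
    using that by (simp add: A_torsion[of X Y] G_diff V_A V_T t_def)
  \<comment> \<open>Skewness cancels in pairs the four terms whose first argument is
    \<open>Y\<close> or \<open>Z\<close> and doubles the one starting with \<open>X\<close>.\<close>
  have "2 * G (A X Y) Z = (G (A X Y) Z - G (A Y X) Z) + (G (A Z X) Y - G (A X Z) Y)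
      - (G (A Y Z) X - G (A Z Y) X)"
    using A_skew[of X Y Z] A_skew[of Y Z X] A_skew[of Z X Y] assms by simp
  also have "\<dots> = - t X Y Z + t Y Z X - t Z X Y"
    using *[of X Y Z] *[of Y Z X] *[of Z X Y] assms by simp
  finally show ?thesis .
qed

text \<open>\<open>dt X\<close> is the covariant derivative along \<open>X\<close> of the trilinear form \<open>t\<close>.\<close>

definition dt :: "'v \<Rightarrow> 'v \<Rightarrow> 'v \<Rightarrow> 'v \<Rightarrow> 'f" where
  "dt X Y Z W = act X (t Y Z W) - t (N X Y) Z W - t Y (N X Z) W - t Y Z (N X W)"

lemma dt_anti:
  assumes "X \<in> V" "Y \<in> V" "Z \<in> V" "W \<in> V"
  shows "dt X Z Y W = - dt X Y Z W"
proof -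
  \<comment> \<open>Metric compatibility moves the derivative from the function onto the field
    \<open>T Y Z\<close>, where the sign comes from additivity of \<open>N\<close>.\<close>
  have "act X (t Y Z W) = G (N X (T Y Z)) W + t Y Z (N X W)"
      "act X (t Z Y W) = G (N X (T Z Y)) W + t Z Y (N X W)"
    using N_metric[of X "T Y Z" W] N_metric[of X "T Z Y" W] assms by (simp_all add: t_def V_T)
  moreover have "G (N X (T Z Y)) W = - G (N X (T Y Z)) W"
  proof -
    have "N X (T Y Z) + N X (T Z Y) = N X 0"
      using assms N_add2[of X "T Y Z" "T Z Y"] by (simp add: V_T V_uminus T_anti[of Y Z])
    then have "G (N X (T Y Z)) W + G (N X (T Z Y)) W = 0"
      using assms N_add2[of X 0 0] by (simp add: V_T V_intros G_zero flip: G_add)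
    then show ?thesis
      by (simp add: eq_neg_iff_add_eq_0 add.commute)
  qed
  ultimately show ?thesis
    using assms unfolding dt_def
    by (simp only: t_anti[of Y Z] t_anti[of "N X Y" Z] t_anti[of Y "N X Z"] V_N) simp
qed

section \<open>The Levi-Civita curvature in terms of the canonical connection\<close>

text \<open>Substitutes \<open>D = N + A\<close> twice. \<open>N_metric\<close> and
  \<open>A_skew\<close> arrange that \<open>A\<close> is never differentiated as a field and never
  nested, so that it occurs only in pairings accessible to \<open>A_eq\<close>.\<close>

lemma DD_eq:
  assumes "X \<in> V" "Y \<in> V" "Z \<in> V" "W \<in> V"
  shows "G (D X (D Y Z)) W = G (N X (N Y Z)) W + act X (G (A Y Z) W) - G (A Y Z) (N X W)
      + G (A X (N Y Z)) W - G (A Y Z) (A X W)"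
proof -
  have D: "D P Q = N P Q + A P Q" for P Q
    by (simp add: A_def)
  have "G (A X (D Y Z)) W = - G (A X W) (N Y Z + A Y Z)"
    using assms by (simp add: A_skew[of X _ W] V_intros V_A D)
  also have "\<dots> = G (A X (N Y Z)) W - G (A Y Z) (A X W)"
    using assms by (simp add: A_skew[of X _ W] G_add2 V_intros V_A G_sym[of "A X W"])
  finally have "G (D X (D Y Z)) W = G (N X (N Y Z + A Y Z)) W + G (A X (N Y Z)) W - G (A Y Z) (A X W)"
    using assms by (simp add: D[of X] G_add V_intros V_A) (simp add: D[of Y])
  then show ?thesis
    using assms N_metric[of X "A Y Z" W] by (simp add: N_add2 G_add V_intros V_A)
qed

lemma RL_eq:
  assumes "X \<in> V" "Y \<in> V" "Z \<in> V" "W \<in> V"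
  shows "G (RL X Y Z) W = G (R X Y Z) W
      + (act X (G (A Y Z) W) - G (A Y Z) (N X W) + G (A X (N Y Z)) W - G (A Y Z) (A X W))
      - (act Y (G (A X Z) W) - G (A X Z) (N Y W) + G (A Y (N X Z)) W - G (A X Z) (A Y W))
      - G (A (br X Y) Z) W"
proof -
  have "G (RL X Y Z) W = G (D X (D Y Z)) W - G (D Y (D X Z)) W - G (N (br X Y) Z) W - G (A (br X Y) Z) W"
    using assms by (simp add: RL_def A_def G_diff V_intros)
  then show ?thesis
    using assms by (simp add: DD_eq R_def G_diff V_intros)
qed

text \<open>The formulas for \<open>A\<close> determine only \<open>2 * G (A X Y) Z\<close>; this
  moves the factor 2 under the derivative, where they apply without dividing.\<close>

lemma act_double: "X \<in> V \<Longrightarrow> h \<in> F \<Longrightarrow> 2 * act X h = act X (2 * h)"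
  by (simp only: mult_2 act_add)

text \<open>Among three fields that are not all of the same type exactly one pair has equal types,
  so only one of the three torsion terms in \<open>A_eq\<close> survives.\<close>

lemma A_mixed:
  assumes "X \<in> H b" "Y \<in> H (\<not> b)"
  shows "Z \<in> H b \<Longrightarrow> 2 * G (A X Y) Z = t X Z Y"
    and "Z \<in> H (\<not> b) \<Longrightarrow> 2 * G (A X Y) Z = t Y Z X"
    and "Z \<in> H (\<not> b) \<Longrightarrow> 2 * G (A Y X) Z = t Y Z X"
proof -
  have *: "X \<in> V" "Y \<in> V" "Z \<in> H c \<Longrightarrow> Z \<in> V" for c
    using assms H_V by blast+
  { assume Z: "Z \<in> H b"
    show "2 * G (A X Y) Z = t X Z Y"
      using assms Z *(1,2) *(3)[OF Z] t_H[of X b Y] t_H[of Z b Y]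
      by (simp add: A_eq t_anti[of X Z] t_anti[of Z Y] eq_commute[of 0]) }
  { assume Z: "Z \<in> H (\<not> b)"
    show "2 * G (A X Y) Z = t Y Z X"
      using assms Z *(1,2) *(3)[OF Z] t_H[of X b Y] t_H[of X b Z]
      by (simp add: A_eq t_anti[of X Z])
    show "2 * G (A Y X) Z = t Y Z X"
      using assms Z *(1,2) *(3)[OF Z] t_H[of X b Y] t_H[of X b Z]
      by (simp add: A_eq t_anti[of X Y] t_anti[of Y Z]) }
qed

text \<open>The terms of \<open>RL_eq\<close> linear in \<open>A\<close> are the eight terms of the
  two \<open>dt\<close>. Those with \<open>A X (N Y Z)\<close> and \<open>A Y (N X Z)\<close> belong
  to the derivative along the other direction: the first to \<open>dt Y Z X W\<close>, the second to
  \<open>dt X Y W Z\<close>.\<close>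

lemma RL_dt:
  assumes X: "X \<in> H b" and Y: "Y \<in> H (\<not> b)" and Z: "Z \<in> H b" and W: "W \<in> H (\<not> b)"
  shows "2 * G (RL X Y Z) W = 2 * G (R X Y Z) W + dt X Y W Z - dt Y Z X W
      - 2 * G (A Y Z) (A X W) + 2 * G (A X Z) (A Y W)"
proof -
  note V = X[THEN H_V] Y[THEN H_V] Z[THEN H_V] W[THEN H_V]
  note [simp] = V_intros V V_A F_G
  have t0: "t P Q S = 0" "t Q P S = 0" if "P \<in> H b" "Q \<in> H (\<not> b)" "S \<in> V" for P Q S
    using that t_H[of P b Q S] t_H[of Q "\<not> b" P S] by auto
  have AYZ: "2 * G (A Y Z) S = t Y S Z" if "S \<in> H (\<not> b)" for S
    using A_mixed(1)[of Y "\<not> b" Z S] that assms by simp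
  have AXZ: "2 * G (A X S) P = t S X P" if "S \<in> H b" "P \<in> H (\<not> b)" for S P
    using that H_V[OF that(1)] H_V[OF that(2)] X t0
    by (simp add: A_eq t_anti[of S X])
  have br: "br X Y = N X Y - N Y X"
    using torsion_H[OF X Y] by simp
  \<comment> \<open>\<open>N X Y\<close> has the type of \<open>Y\<close> and \<open>N Y X\<close>
    that of \<open>X\<close>, so each half of the bracket keeps one torsion term. These are the
    terms of \<open>dt X Y W Z\<close> and \<open>dt Y Z X W\<close> containing \<open>N X Y\<close>
    and \<open>N Y X\<close>.\<close>
  have "2 * G (A (br X Y) Z) W = t (N X Y) W Z - t Z (N Y X) W"
    using X Y Z W by (simp add: A_eq) (simp add: br t_diff1 t_diff2 t0 N_H t_anti[of _ Z] t_anti[of _ W])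
  moreover have "2 * act X (G (A Y Z) W) = act X (t Y W Z)"
    using AYZ W by (simp add: act_double)
  moreover have "2 * G (A Y Z) (N X W) = t Y (N X W) Z"
    by (rule AYZ) (simp add: N_H W)
  moreover have "2 * G (A X (N Y Z)) W = t (N Y Z) X W"
    by (rule AXZ) (simp_all add: N_H Z W)
  moreover have "2 * act Y (G (A X Z) W) = act Y (t Z X W)"
    using AXZ Z W by (simp add: act_double)
  moreover have "2 * G (A X Z) (N Y W) = t Z X (N Y W)"
    by (rule AXZ) (simp_all add: N_H Z W)
  moreover have "2 * G (A Y (N X Z)) W = t Y W (N X Z)"
    using A_mixed(1)[of Y "\<not> b" "N X Z" W] assms by (simp add: N_H)
  ultimately show ?thesis
    unfolding RL_eq[OF V] dt_def by (simp add: ring_distribs)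
qed

section \<open>Symmetries of the canonical curvature and the first Bianchi identity\<close>

text \<open>Differentiating \<open>G Z W\<close> along \<open>X\<close> and \<open>Y\<close> in both
  orders, the products of first derivatives are symmetric in \<open>X\<close> and \<open>Y\<close>
  and cancel; by \<open>act_br\<close> the rest is the derivative along
  \<open>br X Y\<close>.\<close>

lemma R_skew:
  assumes "X \<in> V" "Y \<in> V" "Z \<in> V" "W \<in> V"
  shows "G (R X Y Z) W = - G (R X Y W) Z"
proof -
  have "act P (act Q (G Z W)) = G (N P (N Q Z)) W + G (N Q Z) (N P W) + G (N P Z) (N Q W) + G Z (N P (N Q W))"
    if "P \<in> V" "Q \<in> V" for P Q
    using that assms by (simp add: N_metric act_add V_intros F_G)
  then have "act (br X Y) (G Z W) = G (N X (N Y Z)) W + G Z (N X (N Y W)) - G (N Y (N X Z)) W - G Z (N Y (N X W))"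
    using assms by (simp add: act_br F_G)
  moreover have "act (br X Y) (G Z W) = G (N (br X Y) Z) W + G Z (N (br X Y) W)"
    using assms by (simp add: N_metric V_intros)
  moreover have "G (R X Y Z) W + G Z (R X Y W) =
      G (N X (N Y Z)) W + G Z (N X (N Y W)) - G (N Y (N X Z)) W - G Z (N Y (N X W))
      - (G (N (br X Y) Z) W + G Z (N (br X Y) W))"
    using assms by (simp add: R_def G_diff G_diff2 V_intros)
  ultimately have "G (R X Y Z) W + G Z (R X Y W) = 0"
    by simp
  then show ?thesis
    using assms by (simp add: eq_neg_iff_add_eq_0 R_def V_intros G_sym[of Z])
qed

lemma R_anti: "X \<in> V \<Longrightarrow> Y \<in> V \<Longrightarrow> Z \<in> V \<Longrightarrow> R Y X Z = - R X Y Z"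
  by (simp add: R_def br_anti[of X Y] N_uminus1 V_intros)

lemma R_H:
  assumes "X \<in> V" "Y \<in> V" "Z \<in> H b" "W \<in> H b"
  shows "G (R X Y Z) W = 0"
proof -
  have "N P Z \<in> H b" "N P (N Q Z) \<in> H b" if "P \<in> V" "Q \<in> V" for P Q
    using that assms N_H by blast+
  then show ?thesis
    using assms H_V[OF assms(3)] H_V[OF assms(4)] by (simp add: R_def G_diff V_intros G_H[of _ b])
qed

text \<open>The term with \<open>T Z X\<close> survives because the torsion of two fields of type
  \<open>b\<close> may have a component of the opposite type, which is the obstruction to
  integrability of the almost complex structure.\<close>

lemma bianchi:
  assumes X: "X \<in> H b" and Y: "Y \<in> H (\<not> b)" and Z: "Z \<in> H b" and W: "W \<in> H (\<not> b)"
  shows "dt Y Z X W = G (R X Y Z) W - G (R Z Y X) W + t Y (T Z X) W"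
proof -
  note V = X[THEN H_V] Y[THEN H_V] Z[THEN H_V] W[THEN H_V]
  note [simp] = V_intros V V_T
  have T0: "T X Y = 0" "T Y Z = 0"
    using T_H[OF X Y] T_H[OF Y, of Z] Z by auto
  \<comment> \<open>Exchanging \<open>Q\<close> and \<open>S\<close> under \<open>N P\<close> costs
    a torsion and a bracket term; in the cyclic sum this cancels all second derivatives.\<close>
  have N2: "N P (N Q S) = N P (N S Q) + N P (T Q S) + N P (br Q S)" if "P \<in> V" "Q \<in> V" "S \<in> V" for P Q S
    using that by (simp add: T_def flip: N_add2)
  have br: "N P Q = N Q P + T P Q + br P Q" for P Q
    by (simp add: T_def)
  have N0: "N P 0 = 0" if "P \<in> V" for P
    using N_add2[of P 0 0] that by simp
  \<comment> \<open>What is left of the form \<open>N P (br Q S) - N (br Q S) P\<close> is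
    \<open>T P (br Q S) + br P (br Q S)\<close>; the double brackets are collected for
    \<open>jacobi\<close>.\<close>
  have "R X Y Z + R Y Z X + R Z X Y = N Y (T Z X) + T X (br Y Z) + T Y (br Z X) + T Z (br X Y)
      + (br X (br Y Z) + br Y (br Z X) + br Z (br X Y))"
    using N2[of X Y Z] N2[of Y Z X] N2[of Z X Y] br[of X "br Y Z"] br[of Y "br Z X"] br[of Z "br X Y"]
    by (simp add: R_def T0 N0)
  then have "G (R X Y Z + R Y Z X + R Z X Y) W
      = G (N Y (T Z X) + T X (br Y Z) + T Y (br Z X) + T Z (br X Y)) W"
    by (simp add: jacobi)
  then have "G (R X Y Z) W + G (R Y Z X) W + G (R Z X Y) W
      = G (N Y (T Z X)) W + t X (br Y Z) W + t Y (br Z X) W + t Z (br X Y) W"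
    by (simp add: G_add t_def R_def)
  \<comment> \<open>The bracket of fields of opposite types is \<open>N Y Z - N Z Y\<close>, and the
    torsion with \<open>X\<close> sees only the summand of type \<open>b\<close>.\<close>
  moreover have "t X (br Y Z) W = - t (N Y Z) X W"
  proof -
    have "t X (br Y Z) W = t X (N Y Z - N Z Y) W"
      using torsion_H[OF Y, of Z] Z by simp
    then show ?thesis
      using X Y by (simp add: t_diff2 t_H[of X b] N_H t_anti[of X])
  qed
  moreover have "t Z (br X Y) W = - t Z (N Y X) W"
    using X Y Z by (simp add: t_diff2 t_H[of Z b] N_H flip: torsion_H)
  \<comment> \<open>\<open>N Z X\<close> and \<open>N X Z\<close> both have the type opposite to
    that of \<open>Y\<close>, so only the torsion part of this bracket contributes.\<close>
  moreover have "t Y (br Z X) W = - t Y (T Z X) W"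
  proof -
    have "br Z X = N Z X - N X Z - T Z X"
      by (simp add: T_def)
    then show ?thesis
      using X Y Z by (simp add: t_diff2 t_H[of Y "\<not> b"] N_H)
  qed
  moreover have "G (N Y (T Z X)) W = act Y (t Z X W) - t Z X (N Y W)"
    using N_metric[of Y "T Z X" W] by (simp add: t_def)
  moreover have "G (R Z X Y) W = 0"
    by (rule R_H) (use Y W in simp_all)
  moreover have "G (R Y Z X) W = - G (R Z Y X) W"
    by (simp add: R_anti[of Z Y] G_uminus V_R)
  ultimately show ?thesis
    by (simp add: dt_def algebra_simps)
qed

lemma RL_R:
  assumes X: "X \<in> H b" and Y: "Y \<in> H (\<not> b)" and Z: "Z \<in> H b" and W: "W \<in> H (\<not> b)"
  shows "2 * G (RL X Y Z) W = G (R X W Z) Y + G (R Z Y X) W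
      - t X (T W Y) Z - t Y (T Z X) W - 2 * G (A Y Z) (A X W) + 2 * G (A X Z) (A Y W)"
proof -
  note V = X[THEN H_V] Y[THEN H_V] Z[THEN H_V] W[THEN H_V]
  \<comment> \<open>\<open>bianchi\<close> with types and roles exchanged. \<open>R_anti\<close> and
    \<open>R_skew\<close> make its first curvature term equal to \<open>G (R X Y Z) W\<close>, as in
    the direct use, and the sign from \<open>dt_anti\<close> lets the two together use up
    \<open>2 * G (R X Y Z) W\<close>.\<close>
  have "dt X W Y Z = G (R Y X W) Z - G (R W X Y) Z + t X (T W Y) Z"
    by (rule bianchi[of Y "\<not> b" X W Z]) (use assms in auto)
  moreover have "G (R Y X W) Z = G (R X Y Z) W"
    using V R_skew[of X Y Z W] by (simp add: R_anti[of X Y] G_uminus V_R)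
  moreover have "G (R W X Y) Z = G (R X W Z) Y"
    using V R_skew[of X W Z Y] by (simp add: R_anti[of X W] G_uminus V_R)
  ultimately show ?thesis
    unfolding RL_dt[OF assms] using bianchi[OF assms] dt_anti[OF V(1,2,4,3)]
    by (simp add: algebra_simps)
qed

text \<open>\<open>RL_R\<close> for \<open>X = e k\<close>, \<open>Y = eb l\<close>,
  \<open>Z = e i\<close>, \<open>W = eb j\<close>, as the last two indices of the curvature are the
  directions. It is doubled so that each factor of a quadratic term can absorb a 2.\<close>

lemma RL_frame:
  fixes i j k l :: 'i
  shows "4 * G (RL (e k) (eb l) (e i)) (eb j) =
      2 * (G (R (e k) (eb j) (e i)) (eb l) + G (R (e i) (eb l) (e k)) (eb j))
      - (\<Sum>m\<in>UNIV. t (eb l) (eb m) (e i) * t (e k) (e m) (eb j)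
          + t (e i) (e m) (eb l) * t (eb j) (eb m) (e k)
          - t (e i) (e k) (eb m) * t (eb j) (eb l) (e m))
      - 2 * (\<Sum>m\<in>UNIV. t (e k) (e m) (e i) * t (eb j) (eb l) (eb m)
          + t (e i) (e k) (e m) * t (eb l) (eb m) (eb j))
      + (\<Sum>m\<in>UNIV. (t (e i) (e k) (e m) + t (e k) (e m) (e i) - t (e m) (e i) (e k))
          * (t (eb j) (eb l) (eb m) + t (eb l) (eb m) (eb j) - t (eb m) (eb j) (eb l)))"
proof -
  have ebF: "eb m \<in> H (\<not> True)" and eF: "e m \<in> H (\<not> False)" for m
    using e_H eb_H by auto
  note [simp] = V_frame V_A V_T
  \<comment> \<open>The first argument selects a type: \<open>t (e k)\<close> sees only the
    (1,0)-part of \<open>T (eb j) (eb l)\<close>.\<close>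
  have "t (e k) (T (eb j) (eb l)) (e i) = (\<Sum>m\<in>UNIV. t (e k) (e m) (e i) * t (eb j) (eb l) (eb m))"
    by (simp add: t_frame[of _ "T _ _"] t_H[OF e_H ebF]) (simp add: t_def mult.commute)
  moreover have "t (eb l) (T (e i) (e k)) (eb j) = (\<Sum>m\<in>UNIV. t (e i) (e k) (e m) * t (eb l) (eb m) (eb j))"
    by (simp add: t_frame[of _ "T _ _"] t_H[OF eb_H eF]) (simp add: t_def)
  \<comment> \<open>By \<open>A_mixed\<close> each component of these two \<open>A\<close> is a
    single torsion coefficient.\<close>
  moreover have "4 * G (A (eb l) (e i)) (A (e k) (eb j)) =
      (\<Sum>m\<in>UNIV. t (eb l) (eb m) (e i) * t (e k) (e m) (eb j)
          + t (e i) (e m) (eb l) * t (eb j) (eb m) (e k))"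
  proof -
    have "4 * G (A (eb l) (e i)) (A (e k) (eb j)) =
      (\<Sum>m\<in>UNIV. (2 * G (A (eb l) (e i)) (eb m)) * (2 * G (A (e k) (eb j)) (e m))
        + (2 * G (A (eb l) (e i)) (e m)) * (2 * G (A (e k) (eb j)) (eb m)))"
      by (subst G_frame) (simp_all add: sum_distrib_left algebra_simps)
    then show ?thesis
      by (simp add: A_mixed(1)[OF eb_H eF eb_H] A_mixed(2)[OF eb_H eF eF]
          A_mixed(1)[OF e_H ebF e_H] A_mixed(2)[OF e_H ebF ebF])
  qed
  \<comment> \<open>Arguments of equal type: for components paired with that type all three terms of
    \<open>A_eq\<close> survive and give the last product of the formula. Paired with the opposite
    type only one term survives, and it gives the remaining product.\<close>
  moreover have "4 * G (A (e k) (e i)) (A (eb l) (eb j)) =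
      (\<Sum>m\<in>UNIV. (t (e i) (e k) (e m) + t (e k) (e m) (e i) - t (e m) (e i) (e k))
          * (t (eb j) (eb l) (eb m) + t (eb l) (eb m) (eb j) - t (eb m) (eb j) (eb l))
        + t (e i) (e k) (eb m) * t (eb j) (eb l) (e m))"
  proof -
    have *: "4 * G (A (e k) (e i)) (A (eb l) (eb j)) =
      (\<Sum>m\<in>UNIV. (2 * G (A (e k) (e i)) (e m)) * (2 * G (A (eb l) (eb j)) (eb m))
         + (2 * G (A (e k) (e i)) (eb m)) * (2 * G (A (eb l) (eb j)) (e m)))"
      by (subst G_frame) (simp_all add: sum_distrib_left algebra_simps)
    have "2 * G (A (e k) (e i)) (e m) = t (e i) (e k) (e m) + t (e k) (e m) (e i) - t (e m) (e i) (e k)" for m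
      by (simp add: A_eq t_anti[of "e i" "e k"] t_anti[of "e k" "e m"] t_anti[of "e m" "e i"])
    moreover have "2 * G (A (eb l) (eb j)) (eb m) = t (eb j) (eb l) (eb m) + t (eb l) (eb m) (eb j) - t (eb m) (eb j) (eb l)" for m
      by (simp add: A_eq t_anti[of "eb j" "eb l"] t_anti[of "eb l" "eb m"] t_anti[of "eb m" "eb j"])
    moreover have "2 * G (A (e k) (e i)) (eb m) = t (e i) (e k) (eb m)" for m
      by (simp add: A_eq t_anti[of "e i" "e k"] t_H[OF e_H ebF] t_H[OF eb_H eF])
    moreover have "2 * G (A (eb l) (eb j)) (e m) = t (eb j) (eb l) (e m)" for m
      by (simp add: A_eq t_anti[of "eb j" "eb l"] t_H[OF e_H ebF] t_H[OF eb_H eF])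
    ultimately show ?thesis
      using * by simp
  qed
  moreover have "4 * G (RL (e k) (eb l) (e i)) (eb j)
      = 2 * (G (R (e k) (eb j) (e i)) (eb l) + G (R (e i) (eb l) (e k)) (eb j))
      - 2 * t (e k) (T (eb j) (eb l)) (e i) - 2 * t (eb l) (T (e i) (e k)) (eb j)
      - 4 * G (A (eb l) (e i)) (A (e k) (eb j)) + 4 * G (A (e k) (e i)) (A (eb l) (eb j))"
    using arg_cong[OF RL_R[OF e_H ebF e_H ebF], of "\<lambda>x. 2 * x" k l i j] by (simp add: algebra_simps)
  ultimately show ?thesis
    by (simp add: sum.distrib sum_subtractf ring_distribs)
qed

end

section \<open>Smooth functions, vector fields and brackets\<close>

lemma Ck_on_subset: "Ck_on k S f \<Longrightarrow> T \<subseteq> S \<Longrightarrow> Ck_on k T f"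
  by (induction k arbitrary: f) (auto intro: continuous_on_subset)

lemma Ck_on_Suc_D: "Ck_on (Suc k) S f \<Longrightarrow> Ck_on k S f"
proof (induction k arbitrary: f)
  case 0
  then show ?case
    by (auto intro!: continuous_at_imp_continuous_on differentiable_imp_continuous_within)
next
  case (Suc k)
  then show ?case
    unfolding Ck_on.simps(2)[of "Suc k"] Ck_on.simps(2)[of k S f] by blast
qed

text \<open>On an open set the derivative is determined by the values on the set. This is how HOL
  expressions for derivatives, and chart expressions meaningful only on the image of a domain, are
  replaced.\<close>

lemma Ck_on_cong:
  assumes "open S" "\<And>x. x \<in> S \<Longrightarrow> f x = g x" "Ck_on k S f"
  shows "Ck_on k S g"
  using assms(2,3)
proof (induction k arbitrary: f g)
  case 0
  then show ?case
    by (simp cong: continuous_on_cong)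
next
  case (Suc k)
  have g: "(g has_derivative frechet_derivative f (at x)) (at x)" if "x \<in> S" for x
  proof (rule has_derivative_transform_within_open[OF _ assms(1) that Suc.prems(1)])
    show "(f has_derivative frechet_derivative f (at x)) (at x)"
      using Suc.prems(2) that by (simp flip: frechet_derivative_works)
  qed
  then have "frechet_derivative f (at x) v = frechet_derivative g (at x) v" if "x \<in> S" for x v
    using that by (metis frechet_derivative_at)
  then have "Ck_on k S (\<lambda>x. frechet_derivative g (at x) v)" for v
    using Suc.IH[of "\<lambda>x. frechet_derivative f (at x) v" "\<lambda>x. frechet_derivative g (at x) v"] Suc.prems(2)
    by simp
  then show ?case
    using g unfolding Ck_on.simps differentiable_def by blast
qed

lemma Ck_on_const: "Ck_on k S (\<lambda>x. c)"
  by (induction k arbitrary: c) (auto simp: frechet_derivative_const)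

lemma Ck_on_add:
  assumes "open S" "Ck_on k S f" "Ck_on k S g"
  shows "Ck_on k S (\<lambda>x. f x + g x)"
  using assms(2,3)
proof (induction k arbitrary: f g)
  case 0
  then show ?case
    by (simp add: continuous_on_add)
next
  case (Suc k)
  then have d: "((\<lambda>x. f x + g x) has_derivative
      (\<lambda>v. frechet_derivative f (at x) v + frechet_derivative g (at x) v)) (at x)" if "x \<in> S" for x
    using that by (intro has_derivative_add) (simp_all flip: frechet_derivative_works)
  have "Ck_on k S (\<lambda>x. frechet_derivative (\<lambda>x. f x + g x) (at x) v)" for v
  proof (rule Ck_on_cong[OF assms(1)])
    show "Ck_on k S (\<lambda>x. frechet_derivative f (at x) v + frechet_derivative g (at x) v)"
      using Suc.prems by (intro Suc.IH) simp_all
  qed (simp flip: frechet_derivative_at[OF d])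
  then show ?case
    using d unfolding Ck_on.simps differentiable_def by blast
qed

lemma Ck_on_mult:
  fixes f g :: "'e::real_normed_vector \<Rightarrow> 'b::real_normed_algebra"
  assumes "open S" "Ck_on k S f" "Ck_on k S g"
  shows "Ck_on k S (\<lambda>x. f x * g x)"
  using assms(2,3)
proof (induction k arbitrary: f g)
  case 0
  then show ?case
    by (simp add: continuous_on_mult)
next
  case (Suc k)
  then have d: "((\<lambda>x. f x * g x) has_derivative
      (\<lambda>v. f x * frechet_derivative g (at x) v + frechet_derivative f (at x) v * g x)) (at x)"
    if "x \<in> S" for x
    using that by (intro has_derivative_mult) (simp_all flip: frechet_derivative_works)
  have "Ck_on k S (\<lambda>x. frechet_derivative (\<lambda>x. f x * g x) (at x) v)" for v
  proof (rule Ck_on_cong[OF assms(1)])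
    show "Ck_on k S (\<lambda>x. f x * frechet_derivative g (at x) v + frechet_derivative f (at x) v * g x)"
      \<comment> \<open>In each product one factor is a derivative of class k and the other is of
        class k + 1, which \<open>Ck_on_Suc_D\<close> lowers.\<close>
      by (rule Ck_on_add[OF assms(1)]; rule Suc.IH)
        (use Suc.prems Ck_on_Suc_D[OF Suc.prems(1)] Ck_on_Suc_D[OF Suc.prems(2)] in simp_all)
  qed (simp flip: frechet_derivative_at[OF d])
  then show ?case
    using d unfolding Ck_on.simps differentiable_def by blast
qed

section \<open>Charts and smooth functions\<close>

locale manifold =
  fixes M :: "'a topology" and \<A> :: "('a, 'e::euclidean_space) atlas"
  assumes smooth_manifold: "smooth_manifold M \<A>"
begin

lemma openin_chart: "(U, \<phi>) \<in> \<A> \<Longrightarrow> openin M U"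
  using smooth_manifold by (auto simp: smooth_manifold_def)

lemma homeomorphic_chart:
  "(U, \<phi>) \<in> \<A> \<Longrightarrow> homeomorphic_map (subtopology M U) (top_of_set (\<phi> ` U)) \<phi>"
  using smooth_manifold by (auto simp: smooth_manifold_def)

lemma inj_on_chart: "(U, \<phi>) \<in> \<A> \<Longrightarrow> inj_on \<phi> U"
  using homeomorphic_imp_injective_map[OF homeomorphic_chart] openin_subset[OF openin_chart]
  by (auto simp: Int_absorb1)

lemma open_chart_image:
  assumes "(U, \<phi>) \<in> \<A>" "openin M W"
  shows "open (\<phi> ` (U \<inter> W))"
proof -
  have "openin (subtopology M U) (U \<inter> W)"
    using assms by (simp add: openin_subtopology_Int2)
  then have "openin (top_of_set (\<phi> ` U)) (\<phi> ` (U \<inter> W))"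
    using homeomorphic_imp_open_map[OF homeomorphic_chart[OF assms(1)]] by (simp add: open_map_def)
  moreover have "open (\<phi> ` U)"
    using assms(1) smooth_manifold by (auto simp: smooth_manifold_def)
  ultimately show ?thesis
    using openin_open_trans by blast
qed

lemma smooth_fun_subset: "smooth_fun \<A> W f \<Longrightarrow> V \<subseteq> W \<Longrightarrow> smooth_fun \<A> V f"
  unfolding smooth_fun_def smooth_on_def by (blast intro: Ck_on_subset)

lemma smooth_fun_cong:
  assumes "openin M W" "\<And>q. q \<in> W \<Longrightarrow> f q = h q" "smooth_fun \<A> W f"
  shows "smooth_fun \<A> W h"
  unfolding smooth_fun_def smooth_on_def
proof (intro ballI allI, clarify)
  fix U \<phi> k assume U: "(U, \<phi>) \<in> \<A>"
  then have "Ck_on k (\<phi> ` (U \<inter> W)) (f \<circ> inv_into U \<phi>)"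
    using assms(3) by (auto simp: smooth_fun_def smooth_on_def)
  moreover have "(f \<circ> inv_into U \<phi>) x = (h \<circ> inv_into U \<phi>) x" if "x \<in> \<phi> ` (U \<inter> W)" for x
    using that assms(2) inj_on_chart[OF U] by auto
  ultimately show "Ck_on k (\<phi> ` (U \<inter> W)) (h \<circ> inv_into U \<phi>)"
    using Ck_on_cong[OF open_chart_image[OF U assms(1)]] by blast
qed

lemma smooth_fun_const: "smooth_fun \<A> W (\<lambda>q. c)"
  by (auto simp: smooth_fun_def smooth_on_def comp_def Ck_on_const)

lemma smooth_fun_add:
  "openin M W \<Longrightarrow> smooth_fun \<A> W f \<Longrightarrow> smooth_fun \<A> W h \<Longrightarrow> smooth_fun \<A> W (\<lambda>q. f q + h q)"
  by (auto simp: smooth_fun_def smooth_on_def comp_def open_chart_image intro!: Ck_on_add)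

lemma smooth_fun_mult:
  "openin M W \<Longrightarrow> smooth_fun \<A> W f \<Longrightarrow> smooth_fun \<A> W h \<Longrightarrow> smooth_fun \<A> W (\<lambda>q. f q * h q)"
  by (auto simp: smooth_fun_def smooth_on_def comp_def open_chart_image intro!: Ck_on_mult)

lemma smooth_fun_diff:
  "openin M W \<Longrightarrow> smooth_fun \<A> W f \<Longrightarrow> smooth_fun \<A> W h \<Longrightarrow> smooth_fun \<A> W (\<lambda>q. f q - h q)"
  using smooth_fun_add[of W f "\<lambda>q. -1 * h q"] smooth_fun_mult[OF _ smooth_fun_const[of W "-1"], of h]
  by simp

lemma smooth_atI: "openin M W \<Longrightarrow> smooth_fun \<A> W f \<Longrightarrow> p \<in> W \<Longrightarrow> smooth_at M \<A> p f"
  by (auto simp: smooth_at_def)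

lemma smooth_atE:
  assumes "smooth_at M \<A> p f" "openin M W" "p \<in> W"
  obtains V where "openin M V" "V \<subseteq> W" "p \<in> V" "smooth_fun \<A> V f"
proof -
  from assms(1) obtain V where "openin M V" "p \<in> V" "smooth_fun \<A> V f"
    by (auto simp: smooth_at_def)
  then show ?thesis
    using that[of "V \<inter> W"] assms smooth_fun_subset[of V f "V \<inter> W"] by auto
qed

lemma smooth_atE2:
  assumes "smooth_at M \<A> p f" "smooth_at M \<A> p h" "openin M W" "p \<in> W"
  obtains V where "openin M V" "V \<subseteq> W" "p \<in> V" "smooth_fun \<A> V f" "smooth_fun \<A> V h"
proof -
  obtain V where V: "openin M V" "V \<subseteq> W" "p \<in> V" "smooth_fun \<A> V f"
    using smooth_atE[OF assms(1,3,4)] .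
  obtain V' where "openin M V'" "V' \<subseteq> V" "p \<in> V'" "smooth_fun \<A> V' h"
    using smooth_atE[OF assms(2) V(1,3)] .
  then show ?thesis
    using that[of V'] V smooth_fun_subset[of V f V'] by auto
qed

lemma smooth_at_cong:
  assumes "openin M W" "p \<in> W" "\<And>q. q \<in> W \<Longrightarrow> f q = h q"
  shows "smooth_at M \<A> p f \<longleftrightarrow> smooth_at M \<A> p h"
proof -
  have "smooth_at M \<A> p k" if fk: "smooth_at M \<A> p f" "\<And>q. q \<in> W \<Longrightarrow> f q = k q" for f k
  proof -
    obtain V where V: "openin M V" "V \<subseteq> W" "p \<in> V" "smooth_fun \<A> V f"
      using smooth_atE[OF fk(1) assms(1,2)] .
    then show ?thesis
      using fk(2) by (intro smooth_atI[of V] smooth_fun_cong[of V f k]) auto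
  qed
  then show ?thesis
    using assms(3) by metis
qed

section \<open>Tangent vectors as derivations of germs\<close>

lemma tangent_nonsmooth: "v \<in> tangent_space M \<A> p \<Longrightarrow> \<not> smooth_at M \<A> p f \<Longrightarrow> v f = 0"
  by (simp add: tangent_space_def)

text \<open>Smoothness at \<open>p\<close> is a property of the germ; where it fails, both sides are
  the default value 0.\<close>

lemma tangent_cong:
  assumes "v \<in> tangent_space M \<A> p" "openin M W" "p \<in> W" "\<And>q. q \<in> W \<Longrightarrow> f q = h q"
  shows "v f = v h"
proof (cases "smooth_at M \<A> p f")
  case True
  have "\<forall>f h W. smooth_at M \<A> p f \<and> openin M W \<and> p \<in> W \<and> (\<forall>q\<in>W. f q = h q) \<longrightarrow> v f = v h"
    using assms(1) by (simp add: tangent_space_def)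
  then show ?thesis
    using True assms(2-4) by blast
next
  case False
  then show ?thesis
    using assms smooth_at_cong[OF assms(2-4)] by (simp add: tangent_nonsmooth)
qed

lemma tangent_linear:
  "v \<in> tangent_space M \<A> p \<Longrightarrow> smooth_at M \<A> p f \<Longrightarrow> smooth_at M \<A> p h \<Longrightarrow>
   v (\<lambda>q. a * f q + b * h q) = a * v f + b * v h"
  by (simp add: tangent_space_def)

lemma tangent_mult:
  "v \<in> tangent_space M \<A> p \<Longrightarrow> smooth_at M \<A> p f \<Longrightarrow> smooth_at M \<A> p h \<Longrightarrow>
   v (\<lambda>q. f q * h q) = v f * h p + f p * v h"
  by (simp add: tangent_space_def)

lemma tangent_add:
  "v \<in> tangent_space M \<A> p \<Longrightarrow> smooth_at M \<A> p f \<Longrightarrow> smooth_at M \<A> p h \<Longrightarrow>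
   v (\<lambda>q. f q + h q) = v f + v h"
  using tangent_linear[of v p f h 1 1] by simp

lemma tangent_space_comb:
  assumes "u \<in> tangent_space M \<A> p" "v \<in> tangent_space M \<A> p"
  shows "(\<lambda>f. a * u f + b * v f) \<in> tangent_space M \<A> p"
  unfolding tangent_space_def mem_Collect_eq
proof (intro conjI allI impI)
  fix f h W
  assume *: "smooth_at M \<A> p f \<and> openin M W \<and> p \<in> W \<and> (\<forall>q\<in>W. f q = h q)"
  then show "a * u f + b * v f = a * u h + b * v h"
    using tangent_cong[OF assms(1), of W f h] tangent_cong[OF assms(2), of W f h] by simp
qed (use assms in \<open>auto simp: tangent_nonsmooth tangent_linear tangent_mult algebra_simps\<close>)

lemma tangent_space_zero: "p \<in> topspace M \<Longrightarrow> (\<lambda>f. 0) \<in> tangent_space M \<A> p"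
  by (simp add: tangent_space_def)

section \<open>Smooth vector fields and the Lie bracket\<close>

lemma vfield_tangent: "smooth_vfield M \<A> W X \<Longrightarrow> p \<in> W \<Longrightarrow> X p \<in> tangent_space M \<A> p"
  by (simp add: smooth_vfield_def)

lemma vfield_smooth:
  "smooth_vfield M \<A> W X \<Longrightarrow> openin M V \<Longrightarrow> V \<subseteq> W \<Longrightarrow> smooth_fun \<A> V f \<Longrightarrow> smooth_fun \<A> V (\<lambda>q. X q f)"
  by (simp add: smooth_vfield_def)

lemma vfield_subset: "smooth_vfield M \<A> W X \<Longrightarrow> V \<subseteq> W \<Longrightarrow> smooth_vfield M \<A> V X"
  unfolding smooth_vfield_def by blast

lemma vfield_at: "openin M W \<Longrightarrow> smooth_vfield M \<A> W X \<Longrightarrow> p \<in> W \<Longrightarrow> smooth_vfield_at M \<A> p X"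
  by (auto simp: smooth_vfield_at_def)

lemma vfield_cong:
  assumes "\<And>q. q \<in> W \<Longrightarrow> X q = Y q" "smooth_vfield M \<A> W X"
  shows "smooth_vfield M \<A> W Y"
  unfolding smooth_vfield_def
proof (intro conjI allI impI ballI)
  fix V f assume V: "openin M V \<and> V \<subseteq> W \<and> smooth_fun \<A> V f"
  then show "smooth_fun \<A> V (\<lambda>q. Y q f)"
    using assms vfield_smooth[OF assms(2), of V f]
    by (intro smooth_fun_cong[of V "\<lambda>q. X q f" "\<lambda>q. Y q f"]) auto
next
  fix p assume "p \<in> W"
  then show "Y p \<in> tangent_space M \<A> p"
    using assms(1) vfield_tangent[OF assms(2), of p] by simp
qed

lemma vfield_comb:
  assumes "openin M W" "smooth_fun \<A> W a" "smooth_fun \<A> W b" "smooth_vfield M \<A> W X" "smooth_vfield M \<A> W Y"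
  shows "smooth_vfield M \<A> W (\<lambda>q f. a q * X q f + b q * Y q f)"
  unfolding smooth_vfield_def
proof (intro conjI allI impI ballI)
  fix V f assume V: "openin M V \<and> V \<subseteq> W \<and> smooth_fun \<A> V f"
  then show "smooth_fun \<A> V (\<lambda>q. a q * X q f + b q * Y q f)"
    using smooth_fun_subset[OF assms(2), of V] smooth_fun_subset[OF assms(3), of V]
      vfield_smooth[OF assms(4), of V f] vfield_smooth[OF assms(5), of V f]
    by (intro smooth_fun_add smooth_fun_mult) auto
qed (use assms vfield_tangent in \<open>blast intro: tangent_space_comb\<close>)

lemma vfield_add:
  "openin M W \<Longrightarrow> smooth_vfield M \<A> W X \<Longrightarrow> smooth_vfield M \<A> W Y \<Longrightarrow>
    smooth_vfield M \<A> W (\<lambda>q f. X q f + Y q f)"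
  using vfield_comb[OF _ smooth_fun_const[of W 1] smooth_fun_const[of W 1]] by simp

lemma vfield_diff:
  "openin M W \<Longrightarrow> smooth_vfield M \<A> W X \<Longrightarrow> smooth_vfield M \<A> W Y \<Longrightarrow>
    smooth_vfield M \<A> W (\<lambda>q f. X q f - Y q f)"
  using vfield_comb[OF _ smooth_fun_const[of W 1] smooth_fun_const[of W "-1"]] by simp

lemma vfield_zero: "openin M W \<Longrightarrow> smooth_vfield M \<A> W (\<lambda>q f. 0)"
  using tangent_space_zero openin_subset[of M W]
  by (auto simp: smooth_vfield_def smooth_fun_const)

lemma vfield_mult:
  "openin M W \<Longrightarrow> smooth_fun \<A> W a \<Longrightarrow> smooth_vfield M \<A> W X \<Longrightarrow>
    smooth_vfield M \<A> W (\<lambda>q f. a q * X q f)"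
  using vfield_comb[OF _ _ smooth_fun_const[of W 0], of a X X] by simp

text \<open>The commutator of two derivations is a derivation because the cross terms of the product
  rule are symmetric. The rules are applied on a neighbourhood \<open>V\<close> where the given
  functions are smooth.\<close>

lemma vfield_bracket:
  assumes W: "openin M W" and X: "smooth_vfield M \<A> W X" and Y: "smooth_vfield M \<A> W Y"
  shows "smooth_vfield M \<A> W (bracket M \<A> X Y)"
  unfolding smooth_vfield_def
proof (intro conjI allI impI ballI)
  fix V f assume V: "openin M V \<and> V \<subseteq> W \<and> smooth_fun \<A> V f"
  have "smooth_fun \<A> V (\<lambda>q. Z q (\<lambda>q. Z' q f))"
    if "smooth_vfield M \<A> W Z" "smooth_vfield M \<A> W Z'" for Z Z'
    using vfield_smooth[OF that(1), of V "\<lambda>q. Z' q f"] vfield_smooth[OF that(2), of V f] V by simp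
  then have "smooth_fun \<A> V (\<lambda>q. X q (\<lambda>q. Y q f) - Y q (\<lambda>q. X q f))"
    using X Y V by (intro smooth_fun_diff) simp_all
  moreover have "smooth_at M \<A> q f" if "q \<in> V" for q
    using V that smooth_atI by blast
  ultimately show "smooth_fun \<A> V (\<lambda>q. bracket M \<A> X Y q f)"
    using V by (elim smooth_fun_cong[rotated 2]) (simp_all add: bracket_def)
next
  fix p assume p: "p \<in> W"
  note Xp = vfield_tangent[OF X p] and Yp = vfield_tangent[OF Y p]
  show "bracket M \<A> X Y p \<in> tangent_space M \<A> p"
    unfolding tangent_space_def mem_Collect_eq
  proof (intro conjI allI impI)
    fix f assume "\<not> smooth_at M \<A> p f"
    then show "bracket M \<A> X Y p f = 0"
      by (simp add: bracket_def)
  next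
    fix f h W'
    assume *: "smooth_at M \<A> p f \<and> openin M W' \<and> p \<in> W' \<and> (\<forall>q\<in>W'. f q = h q)"
    then have "openin M (W \<inter> W')" "p \<in> W \<inter> W'"
      using W p by auto
    moreover have "Z q f = Z q h" if "smooth_vfield M \<A> W Z" "q \<in> W \<inter> W'" for Z q
      using that * by (intro tangent_cong[OF vfield_tangent, of W Z q W']) auto
    ultimately have "X p (\<lambda>q. Y q f) = X p (\<lambda>q. Y q h)" "Y p (\<lambda>q. X q f) = Y p (\<lambda>q. X q h)"
      using X Y by (auto intro!: tangent_cong[OF Xp] tangent_cong[OF Yp])
    moreover have "smooth_at M \<A> p f \<longleftrightarrow> smooth_at M \<A> p h"
      using * by (intro smooth_at_cong[of W']) auto
    ultimately show "bracket M \<A> X Y p f = bracket M \<A> X Y p h"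
      by (simp add: bracket_def)
  next
    fix f h a b
    assume fh: "smooth_at M \<A> p f \<and> smooth_at M \<A> p h"
    then obtain V where V: "openin M V" "V \<subseteq> W" "p \<in> V" "smooth_fun \<A> V f" "smooth_fun \<A> V h"
      using smooth_atE2 W p by metis
    have Z: "smooth_at M \<A> p (\<lambda>q. Z q k)" if "smooth_vfield M \<A> W Z" "smooth_fun \<A> V k" for Z k
      using vfield_smooth[OF that(1) V(1,2) that(2)] V by (auto intro: smooth_atI)
    have s: "smooth_at M \<A> q f" "smooth_at M \<A> q h" if "q \<in> V" for q
      using V that by (auto intro: smooth_atI)
    have "Z p (\<lambda>q. Z' q (\<lambda>r. a * f r + b * h r)) = a * Z p (\<lambda>q. Z' q f) + b * Z p (\<lambda>q. Z' q h)"
      if Z2: "smooth_vfield M \<A> W Z" "smooth_vfield M \<A> W Z'" for Z Z'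
    proof -
      \<comment> \<open>Linearity of \<open>Z' q\<close> is available for \<open>q\<close> in
        \<open>V\<close>, where \<open>f\<close> and \<open>h\<close> are smooth; as
        \<open>Z p\<close> depends only on germs, this is enough.\<close>
      have "Z p (\<lambda>q. Z' q (\<lambda>r. a * f r + b * h r)) = Z p (\<lambda>q. a * Z' q f + b * Z' q h)"
        using Z2 V s by (intro tangent_cong[OF vfield_tangent[OF Z2(1)] V(1)])
          (auto intro!: tangent_linear intro: vfield_tangent)
      then show ?thesis
        using tangent_linear[OF vfield_tangent[OF Z2(1) p] Z[OF Z2(2) V(4)] Z[OF Z2(2) V(5)]] by simp
    qed
    moreover have "smooth_at M \<A> p (\<lambda>r. a * f r + b * h r)"
      using V by (intro smooth_atI[of V] smooth_fun_add smooth_fun_mult smooth_fun_const)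
    ultimately show "bracket M \<A> X Y p (\<lambda>q. a * f q + b * h q)
        = a * bracket M \<A> X Y p f + b * bracket M \<A> X Y p h"
      using X Y fh by (simp add: bracket_def algebra_simps)
  next
    fix f h
    assume fh: "smooth_at M \<A> p f \<and> smooth_at M \<A> p h"
    then obtain V where V: "openin M V" "V \<subseteq> W" "p \<in> V" "smooth_fun \<A> V f" "smooth_fun \<A> V h"
      using smooth_atE2 W p by metis
    have sV: "smooth_fun \<A> V (\<lambda>q. Z q k)" if "smooth_vfield M \<A> W Z" "smooth_fun \<A> V k" for Z k
      using vfield_smooth[OF that(1) V(1,2) that(2)] .
    have s: "smooth_at M \<A> q k" if "q \<in> V" "smooth_fun \<A> V k" for q k
      using V that by (auto intro: smooth_atI)
    \<comment> \<open>The two middle terms are symmetric in \<open>Z\<close> and \<open>Z'\<close>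
      and disappear in the bracket.\<close>
    have prod: "Z p (\<lambda>q. Z' q (\<lambda>r. f r * h r)) = Z p (\<lambda>q. Z' q f) * h p + Z' p f * Z p h
        + Z p f * Z' p h + f p * Z p (\<lambda>q. Z' q h)"
      if Z2: "smooth_vfield M \<A> W Z" "smooth_vfield M \<A> W Z'" for Z Z'
    proof -
      have "Z p (\<lambda>q. Z' q (\<lambda>r. f r * h r)) = Z p (\<lambda>q. Z' q f * h q + f q * Z' q h)"
        using Z2 V s by (intro tangent_cong[OF vfield_tangent[OF Z2(1)] V(1)])
          (auto intro!: tangent_mult intro: vfield_tangent)
      also have "\<dots> = Z p (\<lambda>q. Z' q f * h q) + Z p (\<lambda>q. f q * Z' q h)"
        using Z2 V p sV by (intro tangent_add[OF vfield_tangent[OF Z2(1)]] s smooth_fun_mult) auto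
      finally show ?thesis
        using tangent_mult[OF vfield_tangent[OF Z2(1) p] s[OF V(3) sV[OF Z2(2) V(4)]] s[OF V(3) V(5)]]
          tangent_mult[OF vfield_tangent[OF Z2(1) p] s[OF V(3) V(4)] s[OF V(3) sV[OF Z2(2) V(5)]]]
        by simp
    qed
    moreover have "smooth_at M \<A> p (\<lambda>r. f r * h r)"
      using V by (intro smooth_atI[of V] smooth_fun_mult)
    ultimately show "bracket M \<A> X Y p (\<lambda>q. f q * h q)
        = bracket M \<A> X Y p f * h p + f p * bracket M \<A> X Y p h"
      using fh by (simp add: bracket_def prod[OF X Y] prod[OF Y X]) (simp add: algebra_simps)
  qed
qed

end

section \<open>Complexified derivations and brackets\<close>

definition csmooth_fun :: "('a, 'e::euclidean_space) atlas \<Rightarrow> 'a set \<Rightarrow> ('a \<Rightarrow> complex) \<Rightarrow> bool" where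
  "csmooth_fun \<A> W h \<longleftrightarrow> smooth_fun \<A> W (\<lambda>q. Re (h q)) \<and> smooth_fun \<A> W (\<lambda>q. Im (h q))"

text \<open>Complexified tangent vectors act on real functions; this extends them complex linearly
  to complex functions, such as the coefficients \<open>cform g p (X p) (Y p)\<close>.\<close>

definition cderiv :: "'a ctvec \<Rightarrow> ('a \<Rightarrow> complex) \<Rightarrow> complex" where
  "cderiv w h = w (\<lambda>q. Re (h q)) + \<i> * w (\<lambda>q. Im (h q))"

lemma smooth_cvfield_iff:
  "smooth_cvfield M \<A> W X \<longleftrightarrow>
    smooth_vfield M \<A> W (\<lambda>p f. Re (X p f)) \<and> smooth_vfield M \<A> W (\<lambda>p f. Im (X p f))"
  by (simp add: smooth_cvfield_def re_fld_def im_fld_def re_vec_def im_vec_def)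

lemma ctangent_space_iff:
  "w \<in> ctangent_space M \<A> p \<longleftrightarrow>
    (\<lambda>f. Re (w f)) \<in> tangent_space M \<A> p \<and> (\<lambda>f. Im (w f)) \<in> tangent_space M \<A> p"
  by (simp add: ctangent_space_def re_vec_def im_vec_def)

context manifold
begin

lemma csmooth_fun_subset: "csmooth_fun \<A> W f \<Longrightarrow> V \<subseteq> W \<Longrightarrow> csmooth_fun \<A> V f"
  by (auto simp: csmooth_fun_def intro: smooth_fun_subset)

lemma csmooth_fun_cong:
  assumes "openin M W" "\<And>q. q \<in> W \<Longrightarrow> f q = h q" "csmooth_fun \<A> W f"
  shows "csmooth_fun \<A> W h"
  using assms(3) smooth_fun_cong[OF assms(1), of "\<lambda>q. Re (f q)" "\<lambda>q. Re (h q)"]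
    smooth_fun_cong[OF assms(1), of "\<lambda>q. Im (f q)" "\<lambda>q. Im (h q)"]
  by (simp add: assms(2) csmooth_fun_def)

lemma csmooth_fun_const: "csmooth_fun \<A> W (\<lambda>q. c)"
  by (simp add: csmooth_fun_def smooth_fun_const)

lemma csmooth_fun_add:
  "openin M W \<Longrightarrow> csmooth_fun \<A> W f \<Longrightarrow> csmooth_fun \<A> W h \<Longrightarrow> csmooth_fun \<A> W (\<lambda>q. f q + h q)"
  by (simp add: csmooth_fun_def smooth_fun_add)

lemma csmooth_fun_mult:
  "openin M W \<Longrightarrow> csmooth_fun \<A> W f \<Longrightarrow> csmooth_fun \<A> W h \<Longrightarrow> csmooth_fun \<A> W (\<lambda>q. f q * h q)"
  by (simp add: csmooth_fun_def smooth_fun_add smooth_fun_mult smooth_fun_diff)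

lemma ctangent_nonsmooth: "w \<in> ctangent_space M \<A> p \<Longrightarrow> \<not> smooth_at M \<A> p f \<Longrightarrow> w f = 0"
  by (auto simp: ctangent_space_iff complex_eq_iff dest: tangent_nonsmooth)

lemma ctangent_cong:
  assumes "w \<in> ctangent_space M \<A> p" "openin M W" "p \<in> W" "\<And>q. q \<in> W \<Longrightarrow> f q = h q"
  shows "w f = w h"
  using tangent_cong[of "\<lambda>f. Re (w f)", OF _ assms(2-4)] tangent_cong[of "\<lambda>f. Im (w f)", OF _ assms(2-4)]
    assms(1) by (simp add: ctangent_space_iff complex_eq_iff)

lemma ctangent_linear:
  assumes "w \<in> ctangent_space M \<A> p" "smooth_at M \<A> p f" "smooth_at M \<A> p h"
  shows "w (\<lambda>q. a * f q + b * h q) = a * w f + b * w h"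
  using tangent_linear[of "\<lambda>f. Re (w f)", OF _ assms(2,3)] tangent_linear[of "\<lambda>f. Im (w f)", OF _ assms(2,3)]
    assms(1) by (simp add: ctangent_space_iff complex_eq_iff)

lemma ctangent_add:
  "w \<in> ctangent_space M \<A> p \<Longrightarrow> smooth_at M \<A> p f \<Longrightarrow> smooth_at M \<A> p h \<Longrightarrow>
    w (\<lambda>q. f q + h q) = w f + w h"
  using ctangent_linear[of w p f h 1 1] by simp

lemma ctangent_diff:
  "w \<in> ctangent_space M \<A> p \<Longrightarrow> smooth_at M \<A> p f \<Longrightarrow> smooth_at M \<A> p h \<Longrightarrow>
    w (\<lambda>q. f q - h q) = w f - w h"
  using ctangent_linear[of w p f h 1 "-1"] by simp

lemma ctangent_mult:
  assumes "w \<in> ctangent_space M \<A> p" "smooth_at M \<A> p f" "smooth_at M \<A> p h"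
  shows "w (\<lambda>q. f q * h q) = w f * h p + f p * w h"
  using tangent_mult[of "\<lambda>f. Re (w f)", OF _ assms(2,3)] tangent_mult[of "\<lambda>f. Im (w f)", OF _ assms(2,3)]
    assms(1) by (simp add: ctangent_space_iff complex_eq_iff)

lemma ctangent_const:
  assumes "w \<in> ctangent_space M \<A> p" "p \<in> topspace M"
  shows "w (\<lambda>q. c) = 0"
proof -
  have 1: "smooth_at M \<A> p (\<lambda>q. 1)"
    using smooth_atI[OF openin_topspace smooth_fun_const assms(2)] .
  have "w (\<lambda>q. 1) = 0"
    using ctangent_mult[OF assms(1) 1 1] by simp
  then show ?thesis
    using ctangent_linear[OF assms(1) 1 1, of c 0] by simp
qed

lemma ctangent_space_comb:
  assumes "u \<in> ctangent_space M \<A> p" "v \<in> ctangent_space M \<A> p"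
  shows "(\<lambda>f. a * u f + b * v f) \<in> ctangent_space M \<A> p"
proof -
  have *: "(\<lambda>f. x * Re (u f) + y * Im (u f) + (z * Re (v f) + t * Im (v f))) \<in> tangent_space M \<A> p" for x y z t
    using tangent_space_comb[OF tangent_space_comb tangent_space_comb,
        of "\<lambda>f. Re (u f)" p "\<lambda>f. Im (u f)" "\<lambda>f. Re (v f)" "\<lambda>f. Im (v f)" 1 x y 1 z t] assms
    by (simp add: ctangent_space_iff)
  show ?thesis
    using *[of "Re a" "- Im a" "Re b" "- Im b"] *[of "Im a" "Re a" "Im b" "Re b"]
    by (simp add: ctangent_space_iff algebra_simps)
qed

lemma ctangent_space_add:
  "u \<in> ctangent_space M \<A> p \<Longrightarrow> v \<in> ctangent_space M \<A> p \<Longrightarrow> (\<lambda>f. u f + v f) \<in> ctangent_space M \<A> p"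
  using ctangent_space_comb[of u p v 1 1] by simp

lemma ctangent_space_scale:
  "u \<in> ctangent_space M \<A> p \<Longrightarrow> (\<lambda>f. a * u f) \<in> ctangent_space M \<A> p"
  using ctangent_space_comb[of u p u a 0] by simp

lemma ctangent_space_cnj:
  "u \<in> ctangent_space M \<A> p \<Longrightarrow> (\<lambda>f. cnj (u f)) \<in> ctangent_space M \<A> p"
  using tangent_space_comb[of "\<lambda>f. Im (u f)" p "\<lambda>f. Im (u f)" "-1" 0]
  by (simp add: ctangent_space_iff)

lemma csmooth_at:
  "openin M W \<Longrightarrow> csmooth_fun \<A> W h \<Longrightarrow> p \<in> W \<Longrightarrow> smooth_at M \<A> p (\<lambda>q. Re (h q))"
  "openin M W \<Longrightarrow> csmooth_fun \<A> W h \<Longrightarrow> p \<in> W \<Longrightarrow> smooth_at M \<A> p (\<lambda>q. Im (h q))"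
  by (auto simp: csmooth_fun_def intro: smooth_atI)

lemma cderiv_cong:
  assumes "w \<in> ctangent_space M \<A> p" "openin M W" "p \<in> W" "\<And>q. q \<in> W \<Longrightarrow> f q = h q"
  shows "cderiv w f = cderiv w h"
  using ctangent_cong[OF assms(1-3), of "\<lambda>q. Re (f q)" "\<lambda>q. Re (h q)"]
    ctangent_cong[OF assms(1-3), of "\<lambda>q. Im (f q)" "\<lambda>q. Im (h q)"] assms(4)
  by (simp add: cderiv_def)

context
  fixes W p w
  assumes W: "openin M W" "p \<in> W" and w: "w \<in> ctangent_space M \<A> p"
begin

lemma cderiv_add:
  assumes "csmooth_fun \<A> W f" "csmooth_fun \<A> W h"
  shows "cderiv w (\<lambda>q. f q + h q) = cderiv w f + cderiv w h"
  using csmooth_at[OF W(1) assms(1) W(2)] csmooth_at[OF W(1) assms(2) W(2)]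
  by (simp add: cderiv_def ctangent_add[OF w] algebra_simps)

lemma cderiv_diff:
  assumes "csmooth_fun \<A> W f" "csmooth_fun \<A> W h"
  shows "cderiv w (\<lambda>q. f q - h q) = cderiv w f - cderiv w h"
  using csmooth_at[OF W(1) assms(1) W(2)] csmooth_at[OF W(1) assms(2) W(2)]
  by (simp add: cderiv_def ctangent_diff[OF w] algebra_simps)

lemma cderiv_mult:
  assumes "csmooth_fun \<A> W f" "csmooth_fun \<A> W h"
  shows "cderiv w (\<lambda>q. f q * h q) = cderiv w f * h p + f p * cderiv w h"
proof -
  note s = csmooth_at[OF W(1) assms(1) W(2)] csmooth_at[OF W(1) assms(2) W(2)]
  have m: "smooth_at M \<A> p (\<lambda>q. k q * l q)"
    if "smooth_at M \<A> p k" "smooth_at M \<A> p l" for k l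
    using smooth_atE2[OF that W] smooth_fun_mult smooth_atI by metis
  show ?thesis
    using s by (simp add: cderiv_def ctangent_diff[OF w] ctangent_add[OF w] ctangent_mult[OF w] m)
      (simp add: complex_eq_iff algebra_simps)
qed

lemma cderiv_cmult:
  assumes "csmooth_fun \<A> W f"
  shows "cderiv w (\<lambda>q. c * f q) = c * cderiv w f"
proof -
  have "cderiv w (\<lambda>q. c) = 0"
    using ctangent_const[OF w] W openin_subset[OF W(1)] by (auto simp: cderiv_def)
  then show ?thesis
    using cderiv_mult[OF csmooth_fun_const assms] by simp
qed

end

section \<open>Smooth complex fields and the complexified bracket\<close>

lemma cvfield_tangent: "smooth_cvfield M \<A> W X \<Longrightarrow> p \<in> W \<Longrightarrow> X p \<in> ctangent_space M \<A> p"
  using vfield_tangent by (fastforce simp: smooth_cvfield_iff ctangent_space_iff)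

lemma cvfield_subset: "smooth_cvfield M \<A> W X \<Longrightarrow> V \<subseteq> W \<Longrightarrow> smooth_cvfield M \<A> V X"
  using vfield_subset by (auto simp: smooth_cvfield_iff)

lemma cvfield_cong:
  assumes "\<And>q. q \<in> W \<Longrightarrow> X q = Y q" "smooth_cvfield M \<A> W X"
  shows "smooth_cvfield M \<A> W Y"
  using assms(2) vfield_cong[of W "\<lambda>q f. Re (X q f)" "\<lambda>q f. Re (Y q f)"]
    vfield_cong[of W "\<lambda>q f. Im (X q f)" "\<lambda>q f. Im (Y q f)"]
  by (simp add: assms(1) smooth_cvfield_iff)

lemma cvfield_smooth:
  assumes "smooth_cvfield M \<A> W X" "openin M W" "smooth_fun \<A> W f"
  shows "csmooth_fun \<A> W (\<lambda>q. X q f)"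
  using vfield_smooth[of W "\<lambda>p f. Re (X p f)" W f] vfield_smooth[of W "\<lambda>p f. Im (X p f)" W f] assms
  by (simp add: smooth_cvfield_iff csmooth_fun_def)

lemma csmooth_fun_of_re_im:
  "openin M W \<Longrightarrow> csmooth_fun \<A> W f \<Longrightarrow> csmooth_fun \<A> W h \<Longrightarrow> csmooth_fun \<A> W (\<lambda>q. f q + \<i> * h q)"
  by (intro csmooth_fun_add csmooth_fun_mult csmooth_fun_const)

lemma cderiv_smooth:
  assumes "smooth_cvfield M \<A> W X" "openin M W" "csmooth_fun \<A> W h"
  shows "csmooth_fun \<A> W (\<lambda>q. cderiv (X q) h)"
  using cvfield_smooth[OF assms(1,2), of "\<lambda>q. Re (h q)"] cvfield_smooth[OF assms(1,2), of "\<lambda>q. Im (h q)"] assms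
  unfolding cderiv_def by (intro csmooth_fun_of_re_im) (auto simp: csmooth_fun_def)

lemma cvfield_add:
  "openin M W \<Longrightarrow> smooth_cvfield M \<A> W X \<Longrightarrow> smooth_cvfield M \<A> W Y \<Longrightarrow>
    smooth_cvfield M \<A> W (\<lambda>q f. X q f + Y q f)"
  by (simp add: smooth_cvfield_iff vfield_add)

lemma cvfield_diff:
  "openin M W \<Longrightarrow> smooth_cvfield M \<A> W X \<Longrightarrow> smooth_cvfield M \<A> W Y \<Longrightarrow>
    smooth_cvfield M \<A> W (\<lambda>q f. X q f - Y q f)"
  by (simp add: smooth_cvfield_iff vfield_diff)

lemma cvfield_mult:
  "openin M W \<Longrightarrow> csmooth_fun \<A> W h \<Longrightarrow> smooth_cvfield M \<A> W X \<Longrightarrow>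
    smooth_cvfield M \<A> W (\<lambda>q f. h q * X q f)"
  by (simp add: smooth_cvfield_iff csmooth_fun_def vfield_comb vfield_diff vfield_mult)

lemma cvfield_cnj:
  "openin M W \<Longrightarrow> smooth_cvfield M \<A> W X \<Longrightarrow> smooth_cvfield M \<A> W (cnj_fld X)"
  using vfield_diff[OF _ vfield_zero, of W "\<lambda>p f. Im (X p f)"]
  by (simp add: smooth_cvfield_iff cnj_fld_def)

text \<open>The complex bilinear extension is again a commutator of derivations, so bracket
  identities can be proved with \<open>cderiv\<close> instead of real and imaginary parts.\<close>

lemma cbracket_eq:
  "cbilin (bracket M \<A>) X Y p f = (if smooth_at M \<A> p f
     then cderiv (X p) (\<lambda>q. Y q f) - cderiv (Y p) (\<lambda>q. X q f) else 0)"
  by (simp add: cbilin_def bracket_def cderiv_def re_fld_def im_fld_def re_vec_def im_vec_def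
      complex_eq_iff)

lemma cvfield_cbracket:
  assumes "openin M W" "smooth_cvfield M \<A> W X" "smooth_cvfield M \<A> W Y"
  shows "smooth_cvfield M \<A> W (cbilin (bracket M \<A>) X Y)"
  using assms unfolding smooth_cvfield_def[of M \<A> W X] smooth_cvfield_def[of M \<A> W Y]
  by (simp add: smooth_cvfield_iff cbilin_def vfield_add vfield_diff vfield_bracket)

lemma cbracket_cong:
  assumes W: "openin M W" "p \<in> W" and X: "smooth_cvfield M \<A> W X" and Y: "smooth_cvfield M \<A> W Y"
    and eq: "\<And>q. q \<in> W \<Longrightarrow> X q = X' q" "\<And>q. q \<in> W \<Longrightarrow> Y q = Y' q"
  shows "cbilin (bracket M \<A>) X Y p = cbilin (bracket M \<A>) X' Y' p"
proof
  fix f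
  have "cderiv (X p) (\<lambda>q. Y q f) = cderiv (X p) (\<lambda>q. Y' q f)"
    by (rule cderiv_cong[OF cvfield_tangent[OF X W(2)] W]) (simp add: eq)
  moreover have "cderiv (Y p) (\<lambda>q. X q f) = cderiv (Y p) (\<lambda>q. X' q f)"
    by (rule cderiv_cong[OF cvfield_tangent[OF Y W(2)] W]) (simp add: eq)
  ultimately show "cbilin (bracket M \<A>) X Y p f = cbilin (bracket M \<A>) X' Y' p f"
    using eq W(2) by (simp add: cbracket_eq)
qed

lemma cbracket_add:
  assumes W: "openin M W" "p \<in> W"
    and X: "smooth_cvfield M \<A> W X" and Y: "smooth_cvfield M \<A> W Y" and Z: "smooth_cvfield M \<A> W Z"
  shows "cbilin (bracket M \<A>) X (\<lambda>q f. Y q f + Z q f) p f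
      = cbilin (bracket M \<A>) X Y p f + cbilin (bracket M \<A>) X Z p f"
proof (cases "smooth_at M \<A> p f")
  case True
  then obtain V where V: "openin M V" "V \<subseteq> W" "p \<in> V" "smooth_fun \<A> V f"
    using W by (rule smooth_atE)
  have "csmooth_fun \<A> V (\<lambda>q. Y q f)" "csmooth_fun \<A> V (\<lambda>q. Z q f)"
    using V Y Z cvfield_smooth cvfield_subset by blast+
  then have "cderiv (X p) (\<lambda>q. Y q f + Z q f) = cderiv (X p) (\<lambda>q. Y q f) + cderiv (X p) (\<lambda>q. Z q f)"
    by (rule cderiv_add[OF V(1,3) cvfield_tangent[OF X W(2)]])
  then show ?thesis
    using True by (simp add: cbracket_eq cderiv_def algebra_simps)
qed (simp add: cbracket_eq)

lemma cbracket_mult: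
  assumes W: "openin M W" "p \<in> W" and h: "csmooth_fun \<A> W h"
    and X: "smooth_cvfield M \<A> W X" and Y: "smooth_cvfield M \<A> W Y"
  shows "cbilin (bracket M \<A>) X (\<lambda>q f. h q * Y q f) p f
      = cderiv (X p) h * Y p f + h p * cbilin (bracket M \<A>) X Y p f"
proof (cases "smooth_at M \<A> p f")
  case True
  then obtain V where V: "openin M V" "V \<subseteq> W" "p \<in> V" "smooth_fun \<A> V f"
    using W by (rule smooth_atE)
  have "csmooth_fun \<A> V h" "csmooth_fun \<A> V (\<lambda>q. Y q f)"
    using V Y h cvfield_smooth cvfield_subset csmooth_fun_subset by blast+
  then have "cderiv (X p) (\<lambda>q. h q * Y q f) = cderiv (X p) h * Y p f + h p * cderiv (X p) (\<lambda>q. Y q f)"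
    by (rule cderiv_mult[OF V(1,3) cvfield_tangent[OF X W(2)]])
  then show ?thesis
    using True by (simp add: cbracket_eq cderiv_def algebra_simps)
next
  \<comment> \<open>Both brackets have the default value 0 here, and so does the Leibniz term, since
    \<open>Y p\<close> vanishes on functions not smooth at \<open>p\<close>.\<close>
  case False
  then show ?thesis
    using ctangent_nonsmooth[OF cvfield_tangent[OF Y W(2)]] by (simp add: cbracket_eq)
qed

text \<open>For real \<open>h\<close> this is \<open>cbracket_eq\<close>; the complex case follows
  by linearity in \<open>h\<close>.\<close>

lemma cderiv_cbracket:
  assumes W: "openin M W" "p \<in> W" and h: "csmooth_fun \<A> W h"
    and X: "smooth_cvfield M \<A> W X" and Y: "smooth_cvfield M \<A> W Y"
  shows "cderiv (cbilin (bracket M \<A>) X Y p) h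
      = cderiv (X p) (\<lambda>q. cderiv (Y q) h) - cderiv (Y p) (\<lambda>q. cderiv (X q) h)"
proof -
  have *: "cderiv (X p) (\<lambda>q. cderiv (Y q) h)
      = cderiv (X p) (\<lambda>q. Y q (\<lambda>q. Re (h q))) + \<i> * cderiv (X p) (\<lambda>q. Y q (\<lambda>q. Im (h q)))"
    if X: "smooth_cvfield M \<A> W X" and Y: "smooth_cvfield M \<A> W Y" for X Y
  proof -
    have s: "csmooth_fun \<A> W (\<lambda>q. Y q (\<lambda>q. Re (h q)))" "csmooth_fun \<A> W (\<lambda>q. Y q (\<lambda>q. Im (h q)))"
      using h[unfolded csmooth_fun_def] by (blast intro: cvfield_smooth[OF Y W(1)])+
    note w = W cvfield_tangent[OF X W(2)]
    show ?thesis
      unfolding cderiv_def[of "Y _"]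
      using cderiv_add[OF w s(1) csmooth_fun_mult[OF W(1) csmooth_fun_const s(2)]] cderiv_cmult[OF w s(2)]
      by simp
  qed
  show ?thesis
    unfolding cderiv_def[of "cbilin _ _ _ _"] *[OF X Y] *[OF Y X]
    using csmooth_at[OF W(1) h W(2)] by (simp add: cbracket_eq algebra_simps)
qed

text \<open>Each double bracket becomes four threefold derivatives of \<open>f\<close>, and the
  twelve terms cancel. \<open>cderiv_cbracket\<close> resolves the derivative along the inner
  bracket.\<close>

lemma cbracket_jacobi:
  assumes W: "openin M W" "p \<in> W"
    and X: "smooth_cvfield M \<A> W X" and Y: "smooth_cvfield M \<A> W Y" and Z: "smooth_cvfield M \<A> W Z"
  shows "cbilin (bracket M \<A>) X (cbilin (bracket M \<A>) Y Z) p f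
      + cbilin (bracket M \<A>) Y (cbilin (bracket M \<A>) Z X) p f
      + cbilin (bracket M \<A>) Z (cbilin (bracket M \<A>) X Y) p f = 0"
proof (cases "smooth_at M \<A> p f")
  case True
  then obtain V where V: "openin M V" "V \<subseteq> W" "p \<in> V" "smooth_fun \<A> V f"
    using W by (rule smooth_atE)
  have *: "cbilin (bracket M \<A>) X (cbilin (bracket M \<A>) Y Z) p f
      = cderiv (X p) (\<lambda>q. cderiv (Y q) (\<lambda>q. Z q f)) - cderiv (X p) (\<lambda>q. cderiv (Z q) (\<lambda>q. Y q f))
      - cderiv (Y p) (\<lambda>q. cderiv (Z q) (\<lambda>q. X q f)) + cderiv (Z p) (\<lambda>q. cderiv (Y q) (\<lambda>q. X q f))"
    if XYZ: "smooth_cvfield M \<A> W X" "smooth_cvfield M \<A> W Y" "smooth_cvfield M \<A> W Z" for X Y Z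
  proof -
    have V': "smooth_cvfield M \<A> V X" "smooth_cvfield M \<A> V Y" "smooth_cvfield M \<A> V Z"
      using XYZ V cvfield_subset by blast+
    have s: "csmooth_fun \<A> V (\<lambda>q. P q f)" if "smooth_cvfield M \<A> V P" for P
      using that V cvfield_smooth by blast
    note Xp = cvfield_tangent[OF V'(1) V(3)]
    have "cderiv (X p) (\<lambda>q. cbilin (bracket M \<A>) Y Z q f)
        = cderiv (X p) (\<lambda>q. cderiv (Y q) (\<lambda>q. Z q f) - cderiv (Z q) (\<lambda>q. Y q f))"
      by (rule cderiv_cong[OF Xp V(1,3)]) (use smooth_atI[OF V(1,4)] in \<open>simp add: cbracket_eq\<close>)
    also have "\<dots> = cderiv (X p) (\<lambda>q. cderiv (Y q) (\<lambda>q. Z q f)) - cderiv (X p) (\<lambda>q. cderiv (Z q) (\<lambda>q. Y q f))"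
      using V' V(1) s by (intro cderiv_diff[OF V(1,3) Xp] cderiv_smooth)
    finally show ?thesis
      using True cderiv_cbracket[OF V(1,3) s[OF V'(1)] V'(2,3)] by (simp add: cbracket_eq[of X])
  qed
  show ?thesis
    by (simp add: *[OF X Y Z] *[OF Y Z X] *[OF Z X Y])
qed (simp add: cbracket_eq)

end

section \<open>Complexified connections and metrics\<close>

context manifold
begin

section \<open>Locality, linearity and Leibniz rule of a connection\<close>

context
  fixes nab :: "'a conn"
  assumes con: "connection M \<A> nab"
begin

lemma nabla_tangent:
  "openin M W \<Longrightarrow> p \<in> W \<Longrightarrow> smooth_vfield M \<A> W Y \<Longrightarrow> v \<in> tangent_space M \<A> p \<Longrightarrow>
    nab p v Y \<in> tangent_space M \<A> p"
  using con vfield_at[of W Y p] openin_subset[of M W] unfolding connection_def by blast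

lemma nabla_comb1:
  "openin M W \<Longrightarrow> p \<in> W \<Longrightarrow> smooth_vfield M \<A> W Y \<Longrightarrow> u \<in> tangent_space M \<A> p \<Longrightarrow>
    v \<in> tangent_space M \<A> p \<Longrightarrow>
    nab p (\<lambda>f. a * u f + b * v f) Y = (\<lambda>f. a * nab p u Y f + b * nab p v Y f)"
  using con vfield_at[of W Y p] openin_subset[of M W] unfolding connection_def by blast

lemma nabla_cong:
  assumes W: "openin M W" "p \<in> W" and Y: "smooth_vfield M \<A> W Y" and v: "v \<in> tangent_space M \<A> p"
    and "\<And>q. q \<in> W \<Longrightarrow> Y q = Z q"
  shows "nab p v Y = nab p v Z"
proof -
  have "\<forall>Z W. openin M W \<and> p \<in> W \<and> (\<forall>q\<in>W. Y q = Z q) \<longrightarrow> nab p v Y = nab p v Z"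
    using con v vfield_at[OF W(1) Y W(2)] openin_subset[OF W(1)] W(2) unfolding connection_def by blast
  then show ?thesis
    using assms by blast
qed

lemma nabla_add2:
  "openin M W \<Longrightarrow> p \<in> W \<Longrightarrow> smooth_vfield M \<A> W Y \<Longrightarrow> smooth_vfield M \<A> W Z \<Longrightarrow>
    v \<in> tangent_space M \<A> p \<Longrightarrow>
    nab p v (\<lambda>q f. Y q f + Z q f) = (\<lambda>f. nab p v Y f + nab p v Z f)"
  using con vfield_at[of W Y p] vfield_at[of W Z p] openin_subset[of M W] unfolding connection_def by blast

lemma nabla_mult2:
  "openin M W \<Longrightarrow> p \<in> W \<Longrightarrow> smooth_vfield M \<A> W Y \<Longrightarrow> smooth_fun \<A> W h \<Longrightarrow>
    v \<in> tangent_space M \<A> p \<Longrightarrow>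
    nab p v (\<lambda>q f. h q * Y q f) = (\<lambda>f. v h * Y p f + h p * nab p v Y f)"
  using con vfield_at[of W Y p] smooth_atI[of W h p] openin_subset[of M W] unfolding connection_def by blast

lemma vfield_cov:
  "openin M W \<Longrightarrow> smooth_vfield M \<A> W X \<Longrightarrow> smooth_vfield M \<A> W Y \<Longrightarrow> smooth_vfield M \<A> W (cov nab X Y)"
  using con[unfolded connection_def, THEN conjunct2] by blast

lemma nabla_uminus2:
  assumes W: "openin M W" "p \<in> W" and Y: "smooth_vfield M \<A> W Y" and v: "v \<in> tangent_space M \<A> p"
  shows "nab p v (\<lambda>q f. - Y q f) = (\<lambda>f. - nab p v Y f)"
proof -
  have 1: "smooth_at M \<A> p (\<lambda>q. 1)"
    using smooth_atI[OF W(1) smooth_fun_const W(2)] .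
  \<comment> \<open>Negation is multiplication by the constant function -1, whose derivative
    vanishes by the product rule for 1 * 1.\<close>
  have "v (\<lambda>q. - 1) = 0"
    using tangent_mult[OF v 1 1] tangent_linear[OF v 1 1, of "-1" 0] by simp
  then show ?thesis
    using nabla_mult2[OF W Y smooth_fun_const v, of "-1"] by simp
qed

lemma ccov_apply:
  "cbilin (cov nab) X Y p f = Complex
    (nab p (\<lambda>f. Re (X p f)) (\<lambda>p f. Re (Y p f)) f - nab p (\<lambda>f. Im (X p f)) (\<lambda>p f. Im (Y p f)) f)
    (nab p (\<lambda>f. Re (X p f)) (\<lambda>p f. Im (Y p f)) f + nab p (\<lambda>f. Im (X p f)) (\<lambda>p f. Re (Y p f)) f)"
  by (simp add: cbilin_def cov_def re_fld_def im_fld_def re_vec_def im_vec_def)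

lemma cvfield_ccov:
  assumes "openin M W" "smooth_cvfield M \<A> W X" "smooth_cvfield M \<A> W Y"
  shows "smooth_cvfield M \<A> W (cbilin (cov nab) X Y)"
  using assms unfolding smooth_cvfield_def[of M \<A> W X] smooth_cvfield_def[of M \<A> W Y]
  by (simp add: smooth_cvfield_iff cbilin_def vfield_add vfield_diff vfield_cov)

context
  fixes W p
  assumes W: "openin M W" "p \<in> W"
begin

text \<open>Tensoriality in \<open>X\<close> and locality in \<open>Y\<close>, which make cutting
  off outside the domain of the frame harmless.\<close>

lemma ccov_cong:
  assumes "smooth_cvfield M \<A> W X" "smooth_cvfield M \<A> W Y"
    and "X p = X' p" "\<And>q. q \<in> W \<Longrightarrow> Y q = Y' q"
  shows "cbilin (cov nab) X Y p = cbilin (cov nab) X' Y' p"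
proof -
  have "nab p v (\<lambda>p f. Re (Y p f)) = nab p v (\<lambda>p f. Re (Y' p f))"
      "nab p v (\<lambda>p f. Im (Y p f)) = nab p v (\<lambda>p f. Im (Y' p f))"
    if "v \<in> tangent_space M \<A> p" for v
    using assms that by (auto intro!: nabla_cong[OF W] simp: smooth_cvfield_iff)
  then show ?thesis
    using cvfield_tangent[OF assms(1) W(2)] assms(3) by (intro ext) (simp add: ccov_apply ctangent_space_iff)
qed

lemma ccov_add1:
  assumes "smooth_cvfield M \<A> W X" "smooth_cvfield M \<A> W Y" "smooth_cvfield M \<A> W Z"
  shows "cbilin (cov nab) (\<lambda>q f. X q f + Y q f) Z p f = cbilin (cov nab) X Z p f + cbilin (cov nab) Y Z p f"
proof -
  have "nab p (\<lambda>f. u f + v f) Z' = (\<lambda>f. nab p u Z' f + nab p v Z' f)"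
    if "u \<in> tangent_space M \<A> p" "v \<in> tangent_space M \<A> p" "smooth_vfield M \<A> W Z'" for u v Z'
    using nabla_comb1[OF W that(3,1,2), of 1 1] by simp
  then show ?thesis
    using assms cvfield_tangent[OF assms(1) W(2)] cvfield_tangent[OF assms(2) W(2)]
    by (simp add: ccov_apply smooth_cvfield_iff ctangent_space_iff complex_eq_iff)
qed

lemma ccov_mult1:
  assumes "smooth_cvfield M \<A> W X" "smooth_cvfield M \<A> W Y"
  shows "cbilin (cov nab) (\<lambda>q f. h q * X q f) Y p f = h p * cbilin (cov nab) X Y p f"
proof -
  have *: "nab p (\<lambda>f. a * u f - b * v f) Z = (\<lambda>f. a * nab p u Z f - b * nab p v Z f)"
      "nab p (\<lambda>f. a * u f + b * v f) Z = (\<lambda>f. a * nab p u Z f + b * nab p v Z f)"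
    if "u \<in> tangent_space M \<A> p" "v \<in> tangent_space M \<A> p" "smooth_vfield M \<A> W Z" for u v Z a b
    using nabla_comb1[OF W that(3,1,2), of a b] nabla_comb1[OF W that(3,1,2), of a "- b"] by simp_all
  show ?thesis
    using assms cvfield_tangent[OF assms(1) W(2)]
    by (simp add: ccov_apply smooth_cvfield_iff ctangent_space_iff *) (simp add: complex_eq_iff algebra_simps)
qed

lemma ccov_add2:
  assumes "smooth_cvfield M \<A> W X" "smooth_cvfield M \<A> W Y" "smooth_cvfield M \<A> W Z"
  shows "cbilin (cov nab) X (\<lambda>q f. Y q f + Z q f) p f = cbilin (cov nab) X Y p f + cbilin (cov nab) X Z p f"
  using assms cvfield_tangent[OF assms(1) W(2)]
  by (simp add: ccov_apply smooth_cvfield_iff ctangent_space_iff nabla_add2[OF W] complex_eq_iff)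

lemma ccov_mult2:
  assumes "smooth_cvfield M \<A> W X" "smooth_cvfield M \<A> W Y" "csmooth_fun \<A> W h"
  shows "cbilin (cov nab) X (\<lambda>q f. h q * Y q f) p f
      = cderiv (X p) h * Y p f + h p * cbilin (cov nab) X Y p f"
proof -
  have sum: "nab p v (\<lambda>q f. a q * S q f + b q * T q f)
      = (\<lambda>f. v a * S p f + a p * nab p v S f + (v b * T p f + b p * nab p v T f))"
    if "v \<in> tangent_space M \<A> p" "smooth_fun \<A> W a" "smooth_fun \<A> W b"
      "smooth_vfield M \<A> W S" "smooth_vfield M \<A> W T" for v S T a b
    using that W by (simp add: nabla_add2[OF W] nabla_mult2[OF W] vfield_mult)
  \<comment> \<open>The real part of a complex product is a difference; it is reduced to
    \<open>sum\<close> by passing to \<open>- T\<close>.\<close>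
  have "nab p v (\<lambda>q f. a q * S q f - b q * T q f)
      = (\<lambda>f. v a * S p f + a p * nab p v S f - (v b * T p f + b p * nab p v T f))"
    if *: "v \<in> tangent_space M \<A> p" "smooth_fun \<A> W a" "smooth_fun \<A> W b"
      "smooth_vfield M \<A> W S" "smooth_vfield M \<A> W T" for v S T a b
  proof -
    have "nab p v (\<lambda>q f. a q * S q f + b q * - T q f)
      = (\<lambda>f. v a * S p f + a p * nab p v S f + (v b * - T p f + b p * - nab p v T f))"
      using * vfield_diff[OF W(1) vfield_zero, of T] W
      by (subst sum) (simp_all add: nabla_uminus2[OF W])
    then show ?thesis
      by (simp add: algebra_simps)
  qed
  with sum show ?thesis
    using assms cvfield_tangent[OF assms(1) W(2)]
    by (simp add: ccov_apply smooth_cvfield_iff ctangent_space_iff csmooth_fun_def cderiv_def)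
      (simp add: complex_eq_iff algebra_simps)
qed

text \<open>The connection is real, so its complex extension commutes with conjugation. This
  transfers results from (1,0)-fields to (0,1)-fields.\<close>

lemma ccov_cnj:
  assumes "smooth_cvfield M \<A> W X" "smooth_cvfield M \<A> W Y"
  shows "cbilin (cov nab) (cnj_fld X) (cnj_fld Y) p f = cnj (cbilin (cov nab) X Y p f)"
proof -
  have *: "nab p (\<lambda>f. - v f) Z = (\<lambda>f. - nab p v Z f)"
    if "v \<in> tangent_space M \<A> p" "smooth_vfield M \<A> W Z" for v Z
    using nabla_comb1[OF W that(2,1,1), of "-1" 0] by simp
  have "(\<lambda>f. - v f) \<in> tangent_space M \<A> p" if "v \<in> tangent_space M \<A> p" for v
    using tangent_space_comb[OF that that, of "-1" 0] by simp
  then show ?thesis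
    using assms cvfield_tangent[OF assms(1) W(2)]
    by (simp add: ccov_apply smooth_cvfield_iff ctangent_space_iff cnj_fld_def * nabla_uminus2[OF W] complex_eq_iff)
qed

end

end

end

locale riemannian = manifold M \<A>
  for M :: "'a topology" and \<A> :: "('a, 'e::euclidean_space) atlas" +
  fixes g :: "'a \<Rightarrow> 'a tvec \<Rightarrow> 'a tvec \<Rightarrow> real"
  assumes riemannian: "riemannian_metric M \<A> g"
begin

section \<open>The complexified metric\<close>

lemma g_sym:
  "p \<in> topspace M \<Longrightarrow> u \<in> tangent_space M \<A> p \<Longrightarrow> v \<in> tangent_space M \<A> p \<Longrightarrow> g p u v = g p v u"
  using riemannian by (simp add: riemannian_metric_def)

lemma g_comb1:
  "p \<in> topspace M \<Longrightarrow> u \<in> tangent_space M \<A> p \<Longrightarrow> v \<in> tangent_space M \<A> p \<Longrightarrow> w \<in> tangent_space M \<A> p \<Longrightarrow>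
    g p (\<lambda>f. a * u f + b * v f) w = a * g p u w + b * g p v w"
  using riemannian by (simp add: riemannian_metric_def)

lemma g_add1:
  "p \<in> topspace M \<Longrightarrow> u \<in> tangent_space M \<A> p \<Longrightarrow> v \<in> tangent_space M \<A> p \<Longrightarrow> w \<in> tangent_space M \<A> p \<Longrightarrow>
    g p (\<lambda>f. u f + v f) w = g p u w + g p v w"
  using g_comb1[of p u v w 1 1] by simp

lemma g_diff1:
  "p \<in> topspace M \<Longrightarrow> u \<in> tangent_space M \<A> p \<Longrightarrow> v \<in> tangent_space M \<A> p \<Longrightarrow> w \<in> tangent_space M \<A> p \<Longrightarrow>
    g p (\<lambda>f. u f - v f) w = g p u w - g p v w"
  using g_comb1[of p u v w 1 "-1"] by simp

lemma g_add2:
  "p \<in> topspace M \<Longrightarrow> u \<in> tangent_space M \<A> p \<Longrightarrow> v \<in> tangent_space M \<A> p \<Longrightarrow> w \<in> tangent_space M \<A> p \<Longrightarrow>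
    g p w (\<lambda>f. u f + v f) = g p w u + g p w v"
  using tangent_space_comb[of u p v 1 1] g_sym[of p w] by (simp add: g_add1)

lemma g_diff2:
  "p \<in> topspace M \<Longrightarrow> u \<in> tangent_space M \<A> p \<Longrightarrow> v \<in> tangent_space M \<A> p \<Longrightarrow> w \<in> tangent_space M \<A> p \<Longrightarrow>
    g p w (\<lambda>f. u f - v f) = g p w u - g p w v"
  using tangent_space_comb[of u p v 1 "-1"] g_sym[of p w] by (simp add: g_diff1)

lemma g_uminus1:
  "p \<in> topspace M \<Longrightarrow> u \<in> tangent_space M \<A> p \<Longrightarrow> w \<in> tangent_space M \<A> p \<Longrightarrow>
    g p (\<lambda>f. - u f) w = - g p u w"
  using g_comb1[of p u u w "-1" 0] by simp

lemma g_uminus2: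
  "p \<in> topspace M \<Longrightarrow> u \<in> tangent_space M \<A> p \<Longrightarrow> w \<in> tangent_space M \<A> p \<Longrightarrow>
    g p w (\<lambda>f. - u f) = - g p w u"
  using tangent_space_comb[of u p u "-1" 0] g_sym[of p w] by (simp add: g_uminus1)

lemma cform_eq:
  "cform g p u v = Complex
     (g p (\<lambda>f. Re (u f)) (\<lambda>f. Re (v f)) - g p (\<lambda>f. Im (u f)) (\<lambda>f. Im (v f)))
     (g p (\<lambda>f. Re (u f)) (\<lambda>f. Im (v f)) + g p (\<lambda>f. Im (u f)) (\<lambda>f. Re (v f)))"
  by (simp add: cform_def re_vec_def im_vec_def)

lemma cform_sym:
  "p \<in> topspace M \<Longrightarrow> u \<in> ctangent_space M \<A> p \<Longrightarrow> v \<in> ctangent_space M \<A> p \<Longrightarrow>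
    cform g p u v = cform g p v u"
  by (simp add: cform_eq ctangent_space_iff g_sym[of p "\<lambda>f. Re (v f)"] g_sym[of p "\<lambda>f. Im (v f)"])

lemma cform_add1:
  "p \<in> topspace M \<Longrightarrow> u \<in> ctangent_space M \<A> p \<Longrightarrow> v \<in> ctangent_space M \<A> p \<Longrightarrow> w \<in> ctangent_space M \<A> p \<Longrightarrow>
    cform g p (\<lambda>f. u f + v f) w = cform g p u w + cform g p v w"
  by (simp add: cform_eq ctangent_space_iff g_add1 complex_eq_iff)

lemma cform_scale1:
  assumes "p \<in> topspace M" "u \<in> ctangent_space M \<A> p" "w \<in> ctangent_space M \<A> p"
  shows "cform g p (\<lambda>f. a * u f) w = a * cform g p u w"
proof -
  have "g p (\<lambda>f. x * s f - y * t f) z = x * g p s z - y * g p t z"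
    if "s \<in> tangent_space M \<A> p" "t \<in> tangent_space M \<A> p" "z \<in> tangent_space M \<A> p" for x y s t z
    using g_comb1[OF assms(1) that, of x "- y"] by simp
  then show ?thesis
    using assms
    by (simp add: cform_eq ctangent_space_iff g_comb1) (simp add: complex_eq_iff algebra_simps)
qed

text \<open>Membership is part of the conclusion because the induction step applies
  \<open>cform_add1\<close> to the partial sum.\<close>

lemma cform_sum1:
  assumes "p \<in> topspace M" "\<And>m. m \<in> I \<Longrightarrow> u m \<in> ctangent_space M \<A> p" "w \<in> ctangent_space M \<A> p"
  shows "cform g p (\<lambda>f. \<Sum>m\<in>I. a m * u m f) w = (\<Sum>m\<in>I. a m * cform g p (u m) w)
    \<and> (\<lambda>f. \<Sum>m\<in>I. a m * u m f) \<in> ctangent_space M \<A> p"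
proof -
  have "cform g p (\<lambda>f. 0) w = 0"
    using cform_scale1[OF assms(1,3,3), of 0] by simp
  moreover have "(\<lambda>f. 0) \<in> ctangent_space M \<A> p"
    using ctangent_space_scale[OF assms(3), of 0] by simp
  ultimately show ?thesis
    using assms(2)
    by (induction I rule: infinite_finite_induct)
      (simp_all add: assms(1,3) cform_add1 cform_scale1 ctangent_space_add ctangent_space_scale)
qed

lemma cform_cnj:
  "p \<in> topspace M \<Longrightarrow> u \<in> ctangent_space M \<A> p \<Longrightarrow> v \<in> ctangent_space M \<A> p \<Longrightarrow>
    cform g p (\<lambda>f. cnj (u f)) (\<lambda>f. cnj (v f)) = cnj (cform g p u v)"
  using tangent_space_comb[of "\<lambda>f. Im (v f)" p "\<lambda>f. Im (v f)" "-1" 0]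
  by (simp add: cform_eq ctangent_space_iff g_uminus1 g_uminus2 complex_eq_iff)

lemma smooth_g:
  "openin M W \<Longrightarrow> smooth_vfield M \<A> W X \<Longrightarrow> smooth_vfield M \<A> W Y \<Longrightarrow>
    smooth_fun \<A> W (\<lambda>p. g p (X p) (Y p))"
  using riemannian[unfolded riemannian_metric_def, THEN conjunct2] by blast

lemma csmooth_cform:
  assumes "openin M W" "smooth_cvfield M \<A> W X" "smooth_cvfield M \<A> W Y"
  shows "csmooth_fun \<A> W (\<lambda>p. cform g p (X p) (Y p))"
proof -
  from smooth_g[OF assms(1), of "\<lambda>p f. Re (X p f)" "\<lambda>p f. Re (Y p f)"] smooth_g[OF assms(1), of "\<lambda>p f. Im (X p f)" "\<lambda>p f. Im (Y p f)"]
    smooth_g[OF assms(1), of "\<lambda>p f. Re (X p f)" "\<lambda>p f. Im (Y p f)"] smooth_g[OF assms(1), of "\<lambda>p f. Im (X p f)" "\<lambda>p f. Re (Y p f)"]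
  show ?thesis
    using assms by (simp add: csmooth_fun_def cform_eq smooth_cvfield_iff smooth_fun_add smooth_fun_diff)
qed

lemma cderiv_cform:
  assumes con: "connection M \<A> nab" and met: "metric_connection M \<A> g nab"
    and W: "openin M W" "p \<in> W"
    and X: "smooth_cvfield M \<A> W X" and Y: "smooth_cvfield M \<A> W Y" and Z: "smooth_cvfield M \<A> W Z"
  shows "cderiv (X p) (\<lambda>p. cform g p (Y p) (Z p))
      = cform g p (cbilin (cov nab) X Y p) (Z p) + cform g p (Y p) (cbilin (cov nab) X Z p)"
proof -
  have p: "p \<in> topspace M"
    using W openin_subset by blast
  have gs: "smooth_at M \<A> p (\<lambda>q. g q (S q) (T q))" if "smooth_vfield M \<A> W S" "smooth_vfield M \<A> W T" for S T
    using smooth_atI[OF W(1) smooth_g[OF W(1) that] W(2)] .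
  have m: "v (\<lambda>q. g q (S q) (T q)) = g p (nab p v S) (T p) + g p (S p) (nab p v T)"
    if "v \<in> tangent_space M \<A> p" "smooth_vfield M \<A> W S" "smooth_vfield M \<A> W T" for v S T
    using met[unfolded metric_connection_def, rule_format, OF p that(1)]
      vfield_at[OF W(1) that(2) W(2)] vfield_at[OF W(1) that(3) W(2)] by simp
  note Xp = cvfield_tangent[OF X W(2)]
  note m' = m[OF Xp[unfolded ctangent_space_iff, THEN conjunct1]] m[OF Xp[unfolded ctangent_space_iff, THEN conjunct2]]
  note [simp] = p nabla_tangent[OF con W] ctangent_add[OF Xp] ctangent_diff[OF Xp] gs m' g_add1 g_add2 g_diff1 g_diff2
  show ?thesis
    using Xp cvfield_tangent[OF Y W(2)] cvfield_tangent[OF Z W(2)] Y Z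
    by (simp add: cderiv_def cform_eq ccov_apply[OF con] ctangent_space_iff smooth_cvfield_iff complex_eq_iff)
qed

end

section \<open>Fields on the domain of a unitary frame\<close>

locale almost_hermitian = riemannian M \<A> g
  for M :: "'a topology" and \<A> :: "('a, 'e::euclidean_space) atlas" and g +
  fixes J :: "'a \<Rightarrow> 'a tvec \<Rightarrow> 'a tvec"
  assumes almost_complex: "almost_complex_structure M \<A> J"
    and g_J: "p \<in> topspace M \<Longrightarrow> u \<in> tangent_space M \<A> p \<Longrightarrow> v \<in> tangent_space M \<A> p \<Longrightarrow>
      g p (J p u) (J p v) = g p u v"
begin

section \<open>The almost complex structure and (1,0)-vectors\<close>

lemma J_tangent: "p \<in> topspace M \<Longrightarrow> u \<in> tangent_space M \<A> p \<Longrightarrow> J p u \<in> tangent_space M \<A> p"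
  using almost_complex by (simp add: almost_complex_structure_def)

lemma J_comb:
  "p \<in> topspace M \<Longrightarrow> u \<in> tangent_space M \<A> p \<Longrightarrow> v \<in> tangent_space M \<A> p \<Longrightarrow>
    J p (\<lambda>f. a * u f + b * v f) = (\<lambda>f. a * J p u f + b * J p v f)"
  using almost_complex by (simp add: almost_complex_structure_def)

lemma J_J: "p \<in> topspace M \<Longrightarrow> u \<in> tangent_space M \<A> p \<Longrightarrow> J p (J p u) = (\<lambda>f. - u f)"
  using almost_complex by (simp add: almost_complex_structure_def)

lemma J_add:
  "p \<in> topspace M \<Longrightarrow> u \<in> tangent_space M \<A> p \<Longrightarrow> v \<in> tangent_space M \<A> p \<Longrightarrow>
    J p (\<lambda>f. u f + v f) = (\<lambda>f. J p u f + J p v f)"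
  using J_comb[of p u v 1 1] by simp

lemma J_diff:
  "p \<in> topspace M \<Longrightarrow> u \<in> tangent_space M \<A> p \<Longrightarrow> v \<in> tangent_space M \<A> p \<Longrightarrow>
    J p (\<lambda>f. u f - v f) = (\<lambda>f. J p u f - J p v f)"
  using J_comb[of p u v 1 "-1"] by simp

lemma J_uminus:
  "p \<in> topspace M \<Longrightarrow> u \<in> tangent_space M \<A> p \<Longrightarrow> J p (\<lambda>f. - u f) = (\<lambda>f. - J p u f)"
  using J_comb[of p u u "-1" 0] by simp

lemma clin_eq:
  "clin J p v = (\<lambda>f. Complex (J p (\<lambda>f. Re (v f)) f) (J p (\<lambda>f. Im (v f)) f))"
  by (simp add: clin_def re_vec_def im_vec_def)

lemma clin_ctangent:
  "p \<in> topspace M \<Longrightarrow> u \<in> ctangent_space M \<A> p \<Longrightarrow> clin J p u \<in> ctangent_space M \<A> p"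
  by (simp add: ctangent_space_iff clin_eq J_tangent)

lemma clin_add:
  "p \<in> topspace M \<Longrightarrow> u \<in> ctangent_space M \<A> p \<Longrightarrow> v \<in> ctangent_space M \<A> p \<Longrightarrow>
    clin J p (\<lambda>f. u f + v f) = (\<lambda>f. clin J p u f + clin J p v f)"
  by (simp add: ctangent_space_iff clin_eq J_add complex_eq_iff fun_eq_iff)

lemma clin_scale:
  assumes "p \<in> topspace M" "u \<in> ctangent_space M \<A> p"
  shows "clin J p (\<lambda>f. a * u f) = (\<lambda>f. a * clin J p u f)"
proof -
  have "J p (\<lambda>f. x * s f - y * t f) = (\<lambda>f. x * J p s f - y * J p t f)"
    if "s \<in> tangent_space M \<A> p" "t \<in> tangent_space M \<A> p" for x y s t
    using J_comb[OF assms(1) that, of x "- y"] by simp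
  then show ?thesis
    using assms by (simp add: ctangent_space_iff clin_eq J_comb complex_eq_iff fun_eq_iff)
qed

lemma clin_clin:
  "p \<in> topspace M \<Longrightarrow> u \<in> ctangent_space M \<A> p \<Longrightarrow> clin J p (clin J p u) = (\<lambda>f. - u f)"
  by (simp add: ctangent_space_iff clin_eq J_J complex_eq_iff fun_eq_iff)

lemma clin_cnj:
  "p \<in> topspace M \<Longrightarrow> u \<in> ctangent_space M \<A> p \<Longrightarrow> clin J p (\<lambda>f. cnj (u f)) = (\<lambda>f. cnj (clin J p u f))"
  by (simp add: ctangent_space_iff clin_eq J_uminus complex_eq_iff fun_eq_iff)

lemma T10_iff:
  "v \<in> T10 M \<A> J p \<longleftrightarrow> v \<in> ctangent_space M \<A> p \<and>
    J p (\<lambda>f. Re (v f)) = (\<lambda>f. - Im (v f)) \<and> J p (\<lambda>f. Im (v f)) = (\<lambda>f. Re (v f))"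
  by (auto simp: T10_def clin_eq fun_eq_iff complex_eq_iff)

text \<open>\<open>J\<close> preserves the form and acts on both vectors as \<i>, so <u,v> = \<i>^2
  <u,v>; the proof carries this out on real and imaginary parts.\<close>

lemma cform_T10:
  assumes "p \<in> topspace M" "u \<in> T10 M \<A> J p" "v \<in> T10 M \<A> J p"
  shows "cform g p u v = 0"
proof -
  have u: "(\<lambda>f. Re (u f)) \<in> tangent_space M \<A> p" "(\<lambda>f. Im (u f)) \<in> tangent_space M \<A> p"
    and v: "(\<lambda>f. Re (v f)) \<in> tangent_space M \<A> p" "(\<lambda>f. Im (v f)) \<in> tangent_space M \<A> p"
    using assms by (auto simp: T10_iff ctangent_space_iff)
  have *: "(\<lambda>f. - Im (v f)) \<in> tangent_space M \<A> p"
    using tangent_space_comb[OF v(2) v(2), of "-1" 0] by simp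
  have "g p (\<lambda>f. Re (u f)) (\<lambda>f. Re (v f)) = g p (\<lambda>f. Im (u f)) (\<lambda>f. Im (v f))"
    using g_J[OF assms(1) u(1) v(1)] assms u v *
    by (simp add: T10_iff g_uminus1 g_uminus2)
  moreover have "g p (\<lambda>f. Re (u f)) (\<lambda>f. Im (v f)) = - g p (\<lambda>f. Im (u f)) (\<lambda>f. Re (v f))"
    using g_J[OF assms(1) u(1) v(2)] assms u v
    by (simp add: T10_iff g_uminus1)
  ultimately show ?thesis
    by (simp add: cform_eq complex_eq_iff)
qed

text \<open>The projection to the \<open>(1,0)\<close>-part. The \<open>(0,1)\<close>-part of \<open>u\<close> is the conjugate of the projection
  of the conjugate of \<open>u\<close>.\<close>

lemma T10_projection:
  assumes p: "p \<in> topspace M" and u: "u \<in> ctangent_space M \<A> p"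
  shows "(\<lambda>f. (u f - \<i> * clin J p u f) / 2) \<in> T10 M \<A> J p"
proof -
  have eq: "(\<lambda>f. (u f - \<i> * clin J p u f) / 2) = (\<lambda>f. (1/2) * u f + (- \<i> / 2) * clin J p u f)"
    by (simp add: field_simps)
  note Ju = clin_ctangent[OF p u]
  have "clin J p (\<lambda>f. (1/2) * u f + (- \<i> / 2) * clin J p u f)
      = (\<lambda>f. (1/2) * clin J p u f + (- \<i> / 2) * - u f)"
    by (subst clin_add[OF p ctangent_space_scale[OF u] ctangent_space_scale[OF Ju]])
      (simp only: clin_scale[OF p u] clin_scale[OF p Ju] clin_clin[OF p u])
  then show ?thesis
    unfolding T10_def eq using ctangent_space_comb[OF u Ju, of "1/2" "- \<i> / 2"]
    by (simp add: field_simps fun_eq_iff)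
qed

text \<open>A connection commuting with \<open>J\<close> preserves its eigenspaces. As
  \<open>nab\<close> acts on real fields, the eigenvalue equation is used in the split form
  \<open>T10_iff\<close>.\<close>

lemma T10_cov:
  assumes con: "connection M \<A> nab" and acc: "almost_complex_connection M \<A> J nab"
    and W: "openin M W" "p \<in> W"
    and X: "smooth_cvfield M \<A> W X" and Y: "smooth_cvfield M \<A> W Y"
    and Y10: "\<And>q. q \<in> W \<Longrightarrow> Y q \<in> T10 M \<A> J q"
  shows "cbilin (cov nab) X Y p \<in> T10 M \<A> J p"
proof -
  have p: "p \<in> topspace M"
    using W openin_subset by blast
  have Yr: "smooth_vfield M \<A> W (\<lambda>q f. Re (Y q f))" and Yi: "smooth_vfield M \<A> W (\<lambda>q f. Im (Y q f))"
    using Y by (auto simp: smooth_cvfield_iff)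
  have Xp: "(\<lambda>f. Re (X p f)) \<in> tangent_space M \<A> p" "(\<lambda>f. Im (X p f)) \<in> tangent_space M \<A> p"
    using cvfield_tangent[OF X W(2)] by (auto simp: ctangent_space_iff)
  have J: "nab p v (\<lambda>q. J q (S q)) = J p (nab p v S)"
    if "v \<in> tangent_space M \<A> p" "smooth_vfield M \<A> W S" for v S
    using acc[unfolded almost_complex_connection_def, rule_format, OF p that(1) vfield_at[OF W(1) that(2) W(2)]] .
  have Yi': "nab p v (\<lambda>q f. Re (Y q f)) = J p (nab p v (\<lambda>q f. Im (Y q f)))"
    if "v \<in> tangent_space M \<A> p" for v
    unfolding J[OF that Yi, symmetric]
    using Y10 by (intro nabla_cong[OF con W Yr that]) (simp add: T10_iff)
  have Yr': "(\<lambda>f. - nab p v (\<lambda>q f. Im (Y q f)) f) = J p (nab p v (\<lambda>q f. Re (Y q f)))"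
    if "v \<in> tangent_space M \<A> p" for v
    unfolding J[OF that Yr, symmetric] nabla_uminus2[OF con W Yi that, symmetric]
    using Y10 vfield_diff[OF W(1) vfield_zero[OF W(1)] Yi]
    by (intro nabla_cong[OF con W _ that]) (simp_all add: T10_iff)
  have t: "nab p v S \<in> tangent_space M \<A> p" if "v \<in> tangent_space M \<A> p" "smooth_vfield M \<A> W S" for v S
    using nabla_tangent[OF con W that(2,1)] .
  show ?thesis
    unfolding T10_iff
    using cvfield_tangent[OF cvfield_ccov[OF con W(1) X Y] W(2)] Xp
    by (simp add: ccov_apply[OF con] J_add[OF p] J_diff[OF p] t Yr Yi flip: Yi' Yr')
qed

end

text \<open>Cutting fields and functions off to \<open>0\<close> outside the domain \<open>U\<close> of the frame turns identities
  over \<open>U\<close> into equalities of HOL functions.\<close>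

definition cut_off :: "'a set \<Rightarrow> ('a \<Rightarrow> 'b::zero) \<Rightarrow> 'a \<Rightarrow> 'b" where
  "cut_off U X = (\<lambda>p. if p \<in> U then X p else 0)"

lemma cut_off_apply [simp]: "p \<in> U \<Longrightarrow> cut_off U X p = X p" "p \<notin> U \<Longrightarrow> cut_off U X p = 0"
  by (simp_all add: cut_off_def)

locale hermitian_frame = almost_hermitian M \<A> g J
  for M :: "'a topology" and \<A> :: "('a, 'e::euclidean_space) atlas" and g J +
  fixes U :: "'a set" and e :: "'n::finite \<Rightarrow> 'a cvfield"
  assumes unitary: "unitary_frame M \<A> J g U e"
begin

section \<open>Expansion in the unitary frame\<close>

lemma U: "openin M U"
  using unitary by (simp add: unitary_frame_def)

lemma topspace_U: "p \<in> U \<Longrightarrow> p \<in> topspace M"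
  using openin_subset[OF U] by blast

lemma smooth_e: "smooth_cvfield M \<A> U (e m)"
  using unitary by (simp add: unitary_frame_def)

lemma e_T10: "p \<in> U \<Longrightarrow> e m p \<in> T10 M \<A> J p"
  using unitary by (simp add: unitary_frame_def)

lemma e_ctangent: "p \<in> U \<Longrightarrow> e m p \<in> ctangent_space M \<A> p"
  by (rule cvfield_tangent[OF smooth_e])

lemma cform_e: "p \<in> U \<Longrightarrow> cform g p (e i p) (\<lambda>f. cnj (e j p f)) = (if i = j then 1 else 0)"
  using unitary by (simp add: unitary_frame_def cnj_fld_def)

lemma T10_expand:
  assumes p: "p \<in> U" and v: "v \<in> T10 M \<A> J p"
  shows "v = (\<lambda>f. \<Sum>m\<in>UNIV. cform g p v (\<lambda>f. cnj (e m p f)) * e m p f)"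
proof -
  obtain c where c: "v = (\<lambda>f. \<Sum>i\<in>UNIV. c i * e i p f)"
    using unitary p v unfolding unitary_frame_def by blast
  have "cform g p v (\<lambda>f. cnj (e m p f)) = (\<Sum>i\<in>UNIV. c i * cform g p (e i p) (\<lambda>f. cnj (e m p f)))" for m
    unfolding c using cform_sum1[OF topspace_U[OF p], of UNIV "\<lambda>i. e i p" _ c] e_ctangent[OF p]
    by (simp add: ctangent_space_cnj)
  then have "cform g p v (\<lambda>f. cnj (e m p f)) = c m" for m
    by (simp add: cform_e[OF p] if_distrib cong: if_cong)
  then show ?thesis
    using c by simp
qed

text \<open>\<open>w\<close> is the sum of its (1,0)-part and the conjugate of the (1,0)-part of its
  conjugate, and \<open>T10_expand\<close> applies to each. The other part does not change the
  coefficients, as it is orthogonal to vectors of its own type.\<close>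

lemma ctangent_expand:
  assumes p: "p \<in> U" and w: "w \<in> ctangent_space M \<A> p"
  shows "w f = (\<Sum>m\<in>UNIV. cform g p w (\<lambda>f. cnj (e m p f)) * e m p f
      + cform g p w (e m p) * cnj (e m p f))"
proof -
  have pM: "p \<in> topspace M"
    using topspace_U[OF p] .
  define P where "P u = (\<lambda>f. (u f - \<i> * clin J p u f) / 2)" for u
  have P: "P u \<in> T10 M \<A> J p" "P u \<in> ctangent_space M \<A> p" if "u \<in> ctangent_space M \<A> p" for u
    using T10_projection[OF pM that] by (auto simp: P_def T10_def)
  have split: "u f = P u f + cnj (P (\<lambda>f. cnj (u f)) f)" if "u \<in> ctangent_space M \<A> p" for u f
    by (simp add: P_def clin_cnj[OF pM that] field_simps)
  have c: "(\<lambda>f. cnj (u f)) \<in> ctangent_space M \<A> p" if "u \<in> ctangent_space M \<A> p" for u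
    using ctangent_space_cnj[OF that] .
  have coeff: "cform g p (P u) (\<lambda>f. cnj (e m p f)) = cform g p u (\<lambda>f. cnj (e m p f))"
    if u: "u \<in> ctangent_space M \<A> p" for u m
  proof -
    have "cform g p u (\<lambda>f. cnj (e m p f))
        = cform g p (\<lambda>f. P u f + cnj (P (\<lambda>f. cnj (u f)) f)) (\<lambda>f. cnj (e m p f))"
      by (simp flip: split[OF u])
    also have "\<dots> = cform g p (P u) (\<lambda>f. cnj (e m p f))"
      using cform_T10[OF pM P(1)[OF c[OF u]] e_T10[OF p]]
      by (simp add: cform_add1[OF pM] cform_cnj[OF pM] P c u e_ctangent[OF p])
    finally show ?thesis
      by simp
  qed
  have "P u f = (\<Sum>m\<in>UNIV. cform g p u (\<lambda>f. cnj (e m p f)) * e m p f)"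
    if "u \<in> ctangent_space M \<A> p" for u
    using fun_cong[OF T10_expand[OF p P(1)[OF that]]] by (simp add: coeff[OF that])
  then show ?thesis
    unfolding split[OF w, of f]
    by (simp add: w c sum.distrib cform_cnj[OF pM] e_ctangent[OF p])
qed

section \<open>The module of fields over the domain of the frame\<close>

definition fields :: "'a cvfield set" where
  "fields = {X. smooth_cvfield M \<A> U X \<and> (\<forall>p. p \<notin> U \<longrightarrow> X p = 0)}"

text \<open>Values outside \<open>U\<close> are left free: a product with a member of
  \<open>fields\<close> is 0 there anyway.\<close>

definition funs :: "('a \<Rightarrow> complex) set" where
  "funs = {h. csmooth_fun \<A> U h}"

definition type_fields :: "bool \<Rightarrow> 'a cvfield set" where
  "type_fields b = {X \<in> fields. \<forall>p\<in>U. (if b then X p else (\<lambda>f. cnj (X p f))) \<in> T10 M \<A> J p}"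

lemma fieldsD: "X \<in> fields \<Longrightarrow> smooth_cvfield M \<A> U X"
  by (simp add: fields_def)

lemma fields_off: "X \<in> fields \<Longrightarrow> p \<notin> U \<Longrightarrow> X p = 0"
  by (simp add: fields_def)

lemma fields_ctangent: "X \<in> fields \<Longrightarrow> p \<in> U \<Longrightarrow> X p \<in> ctangent_space M \<A> p"
  by (rule cvfield_tangent[OF fieldsD])

lemma cut_off_fields: "smooth_cvfield M \<A> U X \<Longrightarrow> cut_off U X \<in> fields"
  using cvfield_cong[of U X "cut_off U X"] by (simp add: fields_def)

lemma fields_zero: "0 \<in> fields"
  using vfield_zero[OF U] by (simp add: fields_def smooth_cvfield_iff)

lemma fields_diff: "X \<in> fields \<Longrightarrow> Y \<in> fields \<Longrightarrow> X - Y \<in> fields"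
  using cvfield_diff[OF U, of X Y] by (simp add: fields_def fun_diff_def zero_fun_def)

lemma fields_mult: "h \<in> funs \<Longrightarrow> X \<in> fields \<Longrightarrow> (\<lambda>p f. h p * X p f) \<in> fields"
  using cvfield_mult[OF U, of h X] by (simp add: fields_def funs_def zero_fun_def)

lemma frame_type_fields:
  "cut_off U (e m) \<in> type_fields True" "cut_off U (cnj_fld (e m)) \<in> type_fields False"
  using cut_off_fields[OF smooth_e] cut_off_fields[OF cvfield_cnj[OF U smooth_e]] e_T10
  by (simp_all add: type_fields_def cnj_fld_def)

lemma type_fields_cnj: "Y \<in> type_fields False \<Longrightarrow> p \<in> U \<Longrightarrow> cnj_fld Y p \<in> T10 M \<A> J p"
  by (simp add: type_fields_def cnj_fld_def)

lemma ccov_type_fields: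
  assumes con: "connection M \<A> nab" and acc: "almost_complex_connection M \<A> J nab"
    and X: "X \<in> fields" and Y: "Y \<in> type_fields b"
  shows "cut_off U (cbilin (cov nab) X Y) \<in> type_fields b"
proof -
  have Y': "Y \<in> fields"
    using Y by (simp add: type_fields_def)
  have "(if b then cbilin (cov nab) X Y p else (\<lambda>f. cnj (cbilin (cov nab) X Y p f))) \<in> T10 M \<A> J p"
    if p: "p \<in> U" for p
  proof (cases b)
    case True
    then show ?thesis
      using Y T10_cov[OF con acc U p fieldsD[OF X] fieldsD[OF Y']] by (simp add: type_fields_def)
  next
    case False
    \<comment> \<open>For (0,1)-fields both arguments are conjugated, \<open>T10_cov\<close> is
      applied, and \<open>ccov_cnj\<close> conjugates back.\<close>
    then have "cbilin (cov nab) (cnj_fld X) (cnj_fld Y) p \<in> T10 M \<A> J p"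
      using Y by (intro T10_cov[OF con acc U p] cvfield_cnj[OF U] fieldsD X Y' type_fields_cnj) simp_all
    moreover have "cbilin (cov nab) (cnj_fld X) (cnj_fld Y) p = (\<lambda>f. cnj (cbilin (cov nab) X Y p f))"
      by (intro ext) (rule ccov_cnj[OF con U p fieldsD[OF X] fieldsD[OF Y']])
    ultimately show ?thesis
      using False by simp
  qed
  then show ?thesis
    using cut_off_fields[OF cvfield_ccov[OF con U fieldsD[OF X] fieldsD[OF Y']]] by (auto simp: type_fields_def split: if_splits)
qed

lemma cform_type_fields:
  assumes X: "X \<in> type_fields b" and Y: "Y \<in> type_fields b" and p: "p \<in> U"
  shows "cform g p (X p) (Y p) = 0"
proof (cases b)
  case True
  then show ?thesis
    using assms cform_T10[OF topspace_U[OF p]] by (simp add: type_fields_def)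
next
  case False
  then have "cnj (cform g p (X p) (Y p)) = 0"
    using assms cform_T10[OF topspace_U[OF p], of "\<lambda>f. cnj (X p f)" "\<lambda>f. cnj (Y p f)"]
      fields_ctangent[of X p] fields_ctangent[of Y p]
    by (simp add: type_fields_def cform_cnj[OF topspace_U[OF p]])
  then show ?thesis
    by simp
qed

context
  fixes nabla nablaL :: "'a conn"
  assumes canonical: "canonical_connection M \<A> J g nabla"
    and levi_civita: "levi_civita_connection M \<A> g nablaL"
begin

section \<open>The canonical and the Levi-Civita connection satisfy the axioms\<close>

lemma con: "connection M \<A> nabla" "metric_connection M \<A> g nabla" "almost_complex_connection M \<A> J nabla"
    "connection M \<A> nablaL" "metric_connection M \<A> g nablaL"
  using canonical levi_civita by (simp_all add: canonical_connection_def levi_civita_connection_def)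

abbreviation "br X Y \<equiv> cut_off U (cbilin (bracket M \<A>) X Y)"
abbreviation "G X Y \<equiv> cut_off U (\<lambda>p. cform g p (X p) (Y p))"
abbreviation "N X Y \<equiv> cut_off U (cbilin (cov nabla) X Y)"
abbreviation "D X Y \<equiv> cut_off U (cbilin (cov nablaL) X Y)"
abbreviation "act X h \<equiv> cut_off U (\<lambda>p. cderiv (X p) h)"

lemma levi_civita_torsion:
  assumes "X \<in> fields" "Y \<in> fields" "p \<in> U"
  shows "cbilin (cov nablaL) X Y p f - cbilin (cov nablaL) Y X p f = cbilin (bracket M \<A>) X Y p f"
proof -
  have "cov nablaL S T p f - cov nablaL T S p f = bracket M \<A> S T p f"
    if "smooth_vfield M \<A> U S" "smooth_vfield M \<A> U T" for S T
    using levi_civita U that assms(3)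
    by (force simp: levi_civita_connection_def torsion_def torsion_of_def fun_eq_iff)
  from this[of "re_fld X" "re_fld Y"] this[of "re_fld X" "im_fld Y"]
    this[of "im_fld X" "re_fld Y"] this[of "im_fld X" "im_fld Y"] this[of "re_fld Y" "re_fld X"]
  show ?thesis
    using fieldsD[OF assms(1)] fieldsD[OF assms(2)]
    by (simp add: cbilin_def smooth_cvfield_def complex_eq_iff)
qed

lemma cbracket_anti: "cbilin (bracket M \<A>) Y X p f = - cbilin (bracket M \<A>) X Y p f"
  by (simp add: cbracket_eq)

text \<open>A (0,1)-field is the conjugate of the (1,0)-field \<open>cnj_fld Y\<close>, which brings
  the pair into the form of \<open>canonical_connection\<close>; the opposite order of types follows
  by antisymmetry.\<close>

lemma canonical_torsion:
  assumes X: "X \<in> type_fields b" and Y: "Y \<in> type_fields (\<not> b)" and p: "p \<in> U"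
  shows "cbilin (cov nabla) X Y p f - cbilin (cov nabla) Y X p f = cbilin (bracket M \<A>) X Y p f"
proof -
  have *: "cbilin (cov nabla) X Y p f - cbilin (cov nabla) Y X p f = cbilin (bracket M \<A>) X Y p f"
    if "X \<in> type_fields True" "Y \<in> type_fields False" for X Y
  proof -
    have f: "X \<in> fields" "Y \<in> fields"
      using that by (auto simp: type_fields_def)
    have "\<forall>p\<in>U. X p \<in> T10 M \<A> J p \<and> cnj_fld Y p \<in> T10 M \<A> J p"
      using that type_fields_cnj by (simp add: type_fields_def)
    then have "ctorsion M \<A> nabla X (cnj_fld (cnj_fld Y)) p = (\<lambda>_. 0)"
      using canonical U p fieldsD[OF f(1)] cvfield_cnj[OF U fieldsD[OF f(2)]]
      unfolding canonical_connection_def by blast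
    then show ?thesis
      by (simp add: ctorsion_def torsion_of_def cnj_fld_def fun_eq_iff)
  qed
  show ?thesis
    using *[of X Y] *[of Y X] X Y cbracket_anti[of X Y p f]
    by (cases b) (auto simp: algebra_simps)
qed

lemma fun_sum_apply: "(\<Sum>m\<in>I. u m) x = (\<Sum>m\<in>I. u m x :: 'b::comm_monoid_add)"
  by (induction I rule: infinite_finite_induct) simp_all

lemma torsion_calculus_fields:
  "torsion_calculus fields funs (\<lambda>h X p f. h p * X p f) act br G N D type_fields
     (\<lambda>m. cut_off U (e m)) (\<lambda>m. cut_off U (cnj_fld (e m)))"
proof
  note sm = fieldsD
  have add: "X + Y = (\<lambda>p f. X p f + Y p f)" for X Y :: "'a cvfield"
    by (intro ext) simp
  have ct: "Y p \<in> ctangent_space M \<A> p" if "Y \<in> fields" "p \<in> U" for Y p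
    using that by (rule fields_ctangent)
  have typed: "X \<in> fields" if "X \<in> type_fields b" for X b
    using that by (simp add: type_fields_def)
  show "(0 :: 'a cvfield) \<in> fields"
    by (rule fields_zero)
  show "X - Y \<in> fields" if "X \<in> fields" "Y \<in> fields" for X Y
    using that by (rule fields_diff)
  show mult: "(\<lambda>p f. h p * X p f) \<in> fields" if "h \<in> funs" "X \<in> fields" for h X
    using that by (rule fields_mult)
  show br: "br X Y \<in> fields" if "X \<in> fields" "Y \<in> fields" for X Y
    using that by (intro cut_off_fields cvfield_cbracket[OF U] fieldsD)
  show N: "N X Y \<in> fields" if "X \<in> fields" "Y \<in> fields" for X Y
    using that by (intro cut_off_fields cvfield_ccov[OF con(1) U] fieldsD)
  show D: "D X Y \<in> fields" if "X \<in> fields" "Y \<in> fields" for X Y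
    using that by (intro cut_off_fields cvfield_ccov[OF con(4) U] fieldsD)
  show G: "G X Y \<in> funs" if "X \<in> fields" "Y \<in> fields" for X Y
    using csmooth_fun_cong[OF U _ csmooth_cform[OF U sm[OF that(1)] sm[OF that(2)]]]
    by (simp add: funs_def)
  show "G X Y = G Y X" if "X \<in> fields" "Y \<in> fields" for X Y
    using that by (auto simp: cut_off_def fun_eq_iff ct topspace_U intro: cform_sym)
  show "G (X + Y) Z = G X Z + G Y Z" if "X \<in> fields" "Y \<in> fields" "Z \<in> fields" for X Y Z
    using that by (auto simp: cut_off_def fun_eq_iff ct topspace_U add cform_add1)
  show "G (\<lambda>p f. h p * X p f) Y = h * G X Y" if "h \<in> funs" "X \<in> fields" "Y \<in> fields" for h X Y
    using that by (auto simp: cut_off_def fun_eq_iff ct topspace_U cform_scale1)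
  show "N (X + Y) Z = N X Z + N Y Z" if "X \<in> fields" "Y \<in> fields" "Z \<in> fields" for X Y Z
    using ccov_add1[OF con(1) U] that by (auto simp: cut_off_def fun_eq_iff add sm)
  show "N X (Y + Z) = N X Y + N X Z" if "X \<in> fields" "Y \<in> fields" "Z \<in> fields" for X Y Z
    using ccov_add2[OF con(1) U] that by (auto simp: cut_off_def fun_eq_iff add sm)
  show "br X (Y + Z) = br X Y + br X Z" if "X \<in> fields" "Y \<in> fields" "Z \<in> fields" for X Y Z
    using cbracket_add[OF U] that by (auto simp: cut_off_def fun_eq_iff add sm)
  show "br Y X = - br X Y" if "X \<in> fields" "Y \<in> fields" for X Y
    using cbracket_anti[of X Y] by (auto simp: cut_off_def fun_eq_iff)
  show "br X (br Y Z) + br Y (br Z X) + br Z (br X Y) = 0"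
    if "X \<in> fields" "Y \<in> fields" "Z \<in> fields" for X Y Z
  proof (intro ext)
    fix p f
    \<comment> \<open>The inner bracket is cut off too, but the outer one depends only on values on
      the open set \<open>U\<close>.\<close>
    have "br P (br Q S) p f = cbilin (bracket M \<A>) P (cbilin (bracket M \<A>) Q S) p f"
      if "p \<in> U" "P \<in> fields" "Q \<in> fields" "S \<in> fields" for P Q S
      using that fun_cong[OF cbracket_cong[OF U that(1) sm[OF that(2)] sm[OF br[OF that(3,4)]], of P "cbilin (bracket M \<A>) Q S"]]
      by simp
    then show "(br X (br Y Z) + br Y (br Z X) + br Z (br X Y)) p f = 0 p f"
      using cbracket_jacobi[OF U _ sm sm sm, of p X Y Z f] that by (cases "p \<in> U") simp_all
  qed
  \<comment> \<open>The Leibniz term \<open>cderiv (X p) h * Y p f\<close> occurs in both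
    \<open>ccov_mult2\<close> and \<open>cbracket_mult\<close> and cancels.\<close>
  show "N X (\<lambda>p f. h p * Y p f) - N (\<lambda>p f. h p * Y p f) X - br X (\<lambda>p f. h p * Y p f)
      = (\<lambda>p f. h p * (N X Y - N Y X - br X Y) p f)"
    if "h \<in> funs" "X \<in> fields" "Y \<in> fields" for h X Y
  proof (intro ext)
    fix p f
    have h: "csmooth_fun \<A> U h"
      using that by (simp add: funs_def)
    show "(N X (\<lambda>p f. h p * Y p f) - N (\<lambda>p f. h p * Y p f) X - br X (\<lambda>p f. h p * Y p f)) p f
      = h p * (N X Y - N Y X - br X Y) p f"
      using ccov_mult2[OF con(1) U _ sm sm h, of p X Y f] ccov_mult1[OF con(1) U _ sm sm, of p Y X h f]
        cbracket_mult[OF U _ h sm sm, of p X Y f] that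
      by (cases "p \<in> U") (simp_all add: algebra_simps)
  qed
  show "act X (f + h) = act X f + act X h" if "X \<in> fields" "f \<in> funs" "h \<in> funs" for X f h
  proof
    fix p show "act X (f + h) p = (act X f + act X h) p"
      using that cderiv_add[OF U _ ct, of p X f h] by (cases "p \<in> U") (simp_all add: funs_def plus_fun_def)
  qed
  show "act (br X Y) h = act X (act Y h) - act Y (act X h)" if "X \<in> fields" "Y \<in> fields" "h \<in> funs" for X Y h
  proof
    fix p
    have "cderiv (P p) (act Q h) = cderiv (P p) (\<lambda>q. cderiv (Q q) h)" if "P \<in> fields" "p \<in> U" for P Q
      by (rule cderiv_cong[OF ct[OF that] U that(2)]) simp
    then show "act (br X Y) h p = (act X (act Y h) - act Y (act X h)) p"
      using that cderiv_cbracket[OF U _ _ sm sm, of p h X Y] by (cases "p \<in> U") (simp_all add: funs_def)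
  qed
  have metric: "act X (G Y Z) = G (cut_off U (cbilin (cov nab) X Y)) Z + G Y (cut_off U (cbilin (cov nab) X Z))"
    if nab: "connection M \<A> nab" "metric_connection M \<A> g nab"
      and "X \<in> fields" "Y \<in> fields" "Z \<in> fields" for nab X Y Z
  proof
    fix p
    have "cderiv (X p) (G Y Z) = cderiv (X p) (\<lambda>q. cform g q (Y q) (Z q))" if "p \<in> U"
      by (rule cderiv_cong[OF ct[OF \<open>X \<in> fields\<close> that] U that]) simp
    then show "act X (G Y Z) p
        = (G (cut_off U (cbilin (cov nab) X Y)) Z + G Y (cut_off U (cbilin (cov nab) X Z))) p"
      using that cderiv_cform[OF nab U _ sm sm sm, of p X Y Z] by (cases "p \<in> U") simp_all
  qed
  show "act X (G Y Z) = G (N X Y) Z + G Y (N X Z)" if "X \<in> fields" "Y \<in> fields" "Z \<in> fields" for X Y Z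
    using metric[OF con(1,2) that] .
  show "act X (G Y Z) = G (D X Y) Z + G Y (D X Z)" if "X \<in> fields" "Y \<in> fields" "Z \<in> fields" for X Y Z
    using metric[OF con(4,5) that] .
  show "D X Y - D Y X = br X Y" if "X \<in> fields" "Y \<in> fields" for X Y
    using levi_civita_torsion[OF that] by (auto simp: cut_off_def fun_eq_iff)
  show "X \<in> fields" if "X \<in> type_fields b" for X b
    using that by (rule typed)
  show "N X Y \<in> type_fields b" if "X \<in> fields" "Y \<in> type_fields b" for X Y b
    using ccov_type_fields[OF con(1,3) that] .
  show "G X Y = 0" if "X \<in> type_fields b" "Y \<in> type_fields b" for X Y b
    using cform_type_fields[OF that] by (auto simp: cut_off_def fun_eq_iff)
  show "N X Y - N Y X = br X Y" if "X \<in> type_fields b" "Y \<in> type_fields (\<not> b)" for X Y b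
    using canonical_torsion[OF that] by (auto simp: cut_off_def fun_eq_iff)
  show "cut_off U (e m) \<in> type_fields True" "cut_off U (cnj_fld (e m)) \<in> type_fields False" for m
    by (rule frame_type_fields)+
  show "X = (\<Sum>m\<in>UNIV. (\<lambda>p f. G X (cut_off U (cnj_fld (e m))) p * cut_off U (e m) p f)
      + (\<lambda>p f. G X (cut_off U (e m)) p * cut_off U (cnj_fld (e m)) p f))" if "X \<in> fields" for X
  proof (intro ext)
    fix p f
    show "X p f = (\<Sum>m\<in>UNIV. (\<lambda>p f. G X (cut_off U (cnj_fld (e m))) p * cut_off U (e m) p f)
      + (\<lambda>p f. G X (cut_off U (e m)) p * cut_off U (cnj_fld (e m)) p f)) p f"
      using ctangent_expand[OF _ ct[OF that], of p f] fields_off[OF that, of p]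
      by (cases "p \<in> U") (simp_all add: fun_sum_apply cnj_fld_def)
  qed
qed

interpretation tc: torsion_calculus fields funs "\<lambda>h X p f. h p * X p f" act br G N D type_fields
    "\<lambda>m. cut_off U (e m)" "\<lambda>m. cut_off U (cnj_fld (e m))"
  by (rule torsion_calculus_fields)

section \<open>Curvature and torsion coefficients in the frame\<close>

text \<open>Connection and bracket are local operators, so at a point of the open set
  \<open>U\<close> the curvature does not notice that fields, also intermediate ones, are cut
  off.\<close>

lemma curvature_cut_off:
  assumes nab: "connection M \<A> nab" and p: "p \<in> U"
    and "smooth_cvfield M \<A> U X" "smooth_cvfield M \<A> U Y" "smooth_cvfield M \<A> U Z"
  defines "C \<equiv> \<lambda>X Y. cut_off U (cbilin (cov nab) X Y)"
  shows "ccurvature M \<A> nab X Y Z p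
    = (C (cut_off U X) (C (cut_off U Y) (cut_off U Z)) - C (cut_off U Y) (C (cut_off U X) (cut_off U Z))
       - C (br (cut_off U X) (cut_off U Y)) (cut_off U Z)) p"
proof -
  have 1: "C (cut_off U P) (cut_off U Q) q = cbilin (cov nab) P Q q"
    if "smooth_cvfield M \<A> U P" "smooth_cvfield M \<A> U Q" "q \<in> U" for P Q q
    using ccov_cong[OF nab U that(3,1,2), of "cut_off U P" "cut_off U Q"] that(3) by (simp add: C_def)
  have 2: "C (cut_off U P) (C (cut_off U Q) (cut_off U S)) p = cbilin (cov nab) P (cbilin (cov nab) Q S) p"
    if "smooth_cvfield M \<A> U P" "smooth_cvfield M \<A> U Q" "smooth_cvfield M \<A> U S" for P Q S
    using ccov_cong[OF nab U p that(1) cvfield_ccov[OF nab U that(2,3)],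
        of "cut_off U P" "C (cut_off U Q) (cut_off U S)"] 1[OF that(2,3)] p by (simp add: C_def)
  have "br (cut_off U X) (cut_off U Y) p = cbilin (bracket M \<A>) X Y p"
    using cbracket_cong[OF U p assms(3,4), of "cut_off U X" "cut_off U Y"] p by simp
  then have 3: "C (br (cut_off U X) (cut_off U Y)) (cut_off U Z) p = cbilin (cov nab) (cbilin (bracket M \<A>) X Y) Z p"
    using ccov_cong[OF nab U p cvfield_cbracket[OF U assms(3,4)] assms(5),
        of "br (cut_off U X) (cut_off U Y)" "cut_off U Z"] p by (simp add: C_def)
  show ?thesis
    using assms(3-5) by (intro ext) (simp add: ccurvature_def curvature_of_def 2 3)
qed

lemma smooth_full_frame: "smooth_cvfield M \<A> U (full_frame e a)"
  by (cases a) (simp_all add: full_frame_def smooth_e cvfield_cnj[OF U])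

lemma frame_curvature_R:
  assumes p: "p \<in> U"
  shows "frame_curvature M \<A> g nabla e p a b c d = G (tc.R (cut_off U (full_frame e c))
      (cut_off U (full_frame e d)) (cut_off U (full_frame e a))) (cut_off U (full_frame e b)) p"
    and "frame_curvature M \<A> g nablaL e p a b c d = G (tc.RL (cut_off U (full_frame e c))
      (cut_off U (full_frame e d)) (cut_off U (full_frame e a))) (cut_off U (full_frame e b)) p"
  using p curvature_cut_off[OF _ p smooth_full_frame smooth_full_frame smooth_full_frame, of _ c d a] con
  by (simp_all add: frame_curvature_def curvature4_def tc.R_def tc.RL_def)

lemma cform_full_frame:
  assumes p: "p \<in> U"
  shows "cform g p (full_frame e a p) (e m p) = (if a = bar m then 1 else 0)"
    and "cform g p (full_frame e a p) (cnj_fld (e m) p) = (if a = hol m then 1 else 0)"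
proof -
  note pM = topspace_U[OF p]
  have "cform g p (e i p) (e m p) = 0" for i
    using cform_T10[OF pM e_T10[OF p] e_T10[OF p]] .
  moreover from this have "cform g p (\<lambda>f. cnj (e i p f)) (\<lambda>f. cnj (e m p f)) = 0" for i
    by (simp add: cform_cnj[OF pM] e_ctangent[OF p])
  moreover have "cform g p (\<lambda>f. cnj (e i p f)) (e m p) = (if i = m then 1 else 0)" for i
    using cform_e[OF p, of m i] by (simp add: cform_sym[OF pM _ e_ctangent[OF p]] e_ctangent[OF p] ctangent_space_cnj)
  ultimately show "cform g p (full_frame e a p) (e m p) = (if a = bar m then 1 else 0)"
    "cform g p (full_frame e a p) (cnj_fld (e m) p) = (if a = hol m then 1 else 0)"
    using cform_e[OF p] by (cases a; simp add: full_frame_def cnj_fld_def)+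
qed

text \<open>The form pairs each frame vector with its own conjugate and with nothing else. Hence
  pairing with \<open>e m\<close> reads off the component \<open>bar m\<close>, and the bar on the
  third argument of \<open>tc.t\<close> is opposite to that on the upper index of
  \<open>\<tau>\<close>.\<close>

lemma torsion_coefficient:
  assumes p: "p \<in> U"
    and \<tau>: "ctorsion M \<A> nabla (full_frame e a) (full_frame e b) p
      = (\<lambda>f. \<Sum>c\<in>UNIV. \<tau> a b c * full_frame e c p f)"
  shows "tc.t (cut_off U (full_frame e a)) (cut_off U (full_frame e b)) (cut_off U (e m)) p = \<tau> a b (bar m)"
    and "tc.t (cut_off U (full_frame e a)) (cut_off U (full_frame e b)) (cut_off U (cnj_fld (e m))) p
      = \<tau> a b (hol m)"
proof -
  note s = smooth_full_frame
  have "N (cut_off U (full_frame e a)) (cut_off U (full_frame e b)) p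
      = cbilin (cov nabla) (full_frame e a) (full_frame e b) p" for a b
    using ccov_cong[OF con(1) U p s s, of a "cut_off U (full_frame e a)" b "cut_off U (full_frame e b)"] p
    by simp
  moreover have "br (cut_off U (full_frame e a)) (cut_off U (full_frame e b)) p
      = cbilin (bracket M \<A>) (full_frame e a) (full_frame e b) p"
    using cbracket_cong[OF U p s s, of a "cut_off U (full_frame e a)" b "cut_off U (full_frame e b)"] p
    by simp
  ultimately have "tc.T (cut_off U (full_frame e a)) (cut_off U (full_frame e b)) p
      = (\<lambda>f. \<Sum>c\<in>UNIV. \<tau> a b c * full_frame e c p f)"
    unfolding \<tau>[symmetric] by (intro ext) (simp add: tc.T_def ctorsion_def torsion_of_def)
  moreover have "cform g p (\<lambda>f. \<Sum>c\<in>UNIV. \<tau> a b c * full_frame e c p f) w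
      = (\<Sum>c\<in>UNIV. \<tau> a b c * cform g p (full_frame e c p) w)" if "w \<in> ctangent_space M \<A> p" for w
    using cform_sum1[OF topspace_U[OF p] _ that, of UNIV "\<lambda>c. full_frame e c p" "\<tau> a b"]
      cvfield_tangent[OF s p] by simp
  ultimately show "tc.t (cut_off U (full_frame e a)) (cut_off U (full_frame e b)) (cut_off U (e m)) p = \<tau> a b (bar m)"
    "tc.t (cut_off U (full_frame e a)) (cut_off U (full_frame e b)) (cut_off U (cnj_fld (e m))) p
      = \<tau> a b (hol m)"
    using p cvfield_tangent[OF smooth_e p, of m] cvfield_tangent[OF cvfield_cnj[OF U smooth_e] p, of m]
    by (simp_all add: tc.t_def cform_full_frame[OF p] if_distrib cong: if_cong)
qed

lemma levi_civita_curvature: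
  fixes \<tau> :: "'n + 'n \<Rightarrow> 'n + 'n \<Rightarrow> 'n + 'n \<Rightarrow> complex"
  assumes p: "p \<in> U"
    and \<tau>: "\<And>a b. ctorsion M \<A> nabla (full_frame e a) (full_frame e b) p
      = (\<lambda>f. \<Sum>c\<in>UNIV. \<tau> a b c * full_frame e c p f)"
  defines "R \<equiv> frame_curvature M \<A> g nabla e" and "RL \<equiv> frame_curvature M \<A> g nablaL e"
  shows "RL p (hol i) (bar j) (hol k) (bar l) =
      1/2 * (R p (hol i) (bar l) (hol k) (bar j) + R p (hol k) (bar j) (hol i) (bar l))
      - 1/4 * (\<Sum>m\<in>UNIV.
            \<tau> (bar l) (bar m) (bar i) * \<tau> (hol k) (hol m) (hol j)
          + \<tau> (hol i) (hol m) (hol l) * \<tau> (bar j) (bar m) (bar k)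
          - \<tau> (hol i) (hol k) (hol m) * \<tau> (bar j) (bar l) (bar m))
      - 1/2 * (\<Sum>m\<in>UNIV.
            \<tau> (hol k) (hol m) (bar i) * \<tau> (bar j) (bar l) (hol m)
          + \<tau> (hol i) (hol k) (bar m) * \<tau> (bar l) (bar m) (hol j))
      + 1/4 * (\<Sum>m\<in>UNIV.
            (\<tau> (hol i) (hol k) (bar m) + \<tau> (hol k) (hol m) (bar i) - \<tau> (hol m) (hol i) (bar k))
          * (\<tau> (bar j) (bar l) (hol m) + \<tau> (bar l) (bar m) (hol j) - \<tau> (bar m) (bar j) (hol l)))"
proof -
  have ff: "full_frame e (hol m) = e m" "full_frame e (bar m) = cnj_fld (e m)" for m
    by (simp_all add: full_frame_def)
  note t = torsion_coefficient[where \<tau> = \<tau>, OF p \<tau>]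
  note t' = t[of "hol x" "hol y" for x y] t[of "hol x" "bar y" for x y]
    t[of "bar x" "hol y" for x y] t[of "bar x" "bar y" for x y]
  \<comment> \<open>\<open>RL_frame\<close> is an identity between functions; at a point its values
    are complex numbers, and the factor 4 can be divided out.\<close>
  have quarter: "x = 1/2 * a - 1/4 * b - 1/2 * c + 1/4 * d" if "4 * x = 2 * a - b - 2 * c + d"
    for x a b c d :: complex
  proof -
    have "x = (2 * a - b - 2 * c + d) / 4"
      by (simp flip: that)
    then show ?thesis
      by (simp add: diff_divide_distrib add_divide_distrib)
  qed
  show ?thesis
    unfolding R_def RL_def
  proof (rule quarter, goal_cases)
    case 1
    show ?case
      using fun_cong[OF tc.RL_frame[where i = i and j = j and k = k and l = l], of p]
      unfolding frame_curvature_R[OF p] ff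
      by (simp only: t'[unfolded ff] fun_sum_apply plus_fun_apply minus_apply times_fun_apply numeral_fun_apply)
  qed
qed

end

end

theorem theorem3p1:
  fixes M :: "'a topology"
    and \<A> :: "('a, 'e::euclidean_space) atlas"
    and J :: "'a \<Rightarrow> 'a tvec \<Rightarrow> 'a tvec"
    and g :: "'a \<Rightarrow> 'a tvec \<Rightarrow> 'a tvec \<Rightarrow> real"
    and nabla nablaL :: "'a conn"
    and U :: "'a set"
    and e :: "'n::finite \<Rightarrow> 'a cvfield"
    and \<tau> :: "'a \<Rightarrow> 'n + 'n \<Rightarrow> 'n + 'n \<Rightarrow> 'n + 'n \<Rightarrow> complex"
    and R RL :: "'a \<Rightarrow> 'n + 'n \<Rightarrow> 'n + 'n \<Rightarrow> 'n + 'n \<Rightarrow> 'n + 'n \<Rightarrow> complex"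
  assumes "DIM('e) = 2 * CARD('n)"
    and "almost_hermitian_manifold M \<A> J g"
    and "canonical_connection M \<A> J g nabla"
    and "levi_civita_connection M \<A> g nablaL"
    and "unitary_frame M \<A> J g U e"
    and "\<And>p a b. p \<in> U \<Longrightarrow> ctorsion M \<A> nabla (full_frame e a) (full_frame e b) p
           = (\<lambda>f. \<Sum>c\<in>UNIV. \<tau> p a b c * full_frame e c p f)"
    and "R = frame_curvature M \<A> g nabla e"
    and "RL = frame_curvature M \<A> g nablaL e"
  shows "\<forall>p\<in>U. \<forall>i j k l.
    RL p (hol i) (bar j) (hol k) (bar l) =
      1/2 * (R p (hol i) (bar l) (hol k) (bar j) + R p (hol k) (bar j) (hol i) (bar l))
      - 1/4 * (\<Sum>m\<in>UNIV.
            \<tau> p (bar l) (bar m) (bar i) * \<tau> p (hol k) (hol m) (hol j)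
          + \<tau> p (hol i) (hol m) (hol l) * \<tau> p (bar j) (bar m) (bar k)
          - \<tau> p (hol i) (hol k) (hol m) * \<tau> p (bar j) (bar l) (bar m))
      - 1/2 * (\<Sum>m\<in>UNIV.
            \<tau> p (hol k) (hol m) (bar i) * \<tau> p (bar j) (bar l) (hol m)
          + \<tau> p (hol i) (hol k) (bar m) * \<tau> p (bar l) (bar m) (hol j))
      + 1/4 * (\<Sum>m\<in>UNIV.
            (\<tau> p (hol i) (hol k) (bar m) + \<tau> p (hol k) (hol m) (bar i) - \<tau> p (hol m) (hol i) (bar k))
          * (\<tau> p (bar j) (bar l) (hol m) + \<tau> p (bar l) (bar m) (hol j) - \<tau> p (bar m) (bar j) (hol l)))"
proof -
  interpret hermitian_frame M \<A> g J U e
    by standard (use assms(2,5) in \<open>auto simp: almost_hermitian_manifold_def\<close>)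
  show ?thesis
    unfolding assms(7,8)
    by (intro ballI allI)
      (rule levi_civita_curvature[where p = p and \<tau> = "\<tau> p" for p, OF assms(3,4) _ assms(6)]; assumption)
qed

end
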